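(* For a positive integer $n$ and a family $\mathcal{F}\subset\mathcal{P}([n])$, write $w(\mathcal{F})=|\mathcal{F}|/2^n$. Let $W(n)$ denote the maximum of $w(\mathcal{F})$ over all families $\mathcal{F}\subset\mathcal{P}([n])$ that are both $3$-wise intersecting (any three members $A_1,A_2,A_3\in\mathcal{F}$, not necessarily distinct, satisfy $A_1\cap A_2\cap A_3\neq\emptyset$) and $3$-intersecting (any two members $A_1,A_2\in\mathcal{F}$ satisfy $|A_1\cap A_2|\ge 3$). For odd $n\ge 7$ define $$\mathcal{F}_n=\{A\subset[n]:1\in A,\ |A|\ge \tfrac{n+3}{2}\}\cup\{A\subset[n]:1\notin A,\ |A|\ge n-2\}.$$ For $\mathcal{F}\subset\mathcal{P}([m])$ and $k\ge 1$ let $\mathcal{F}\times\{0,1\}^k=\{A\subset[m+k]: A\cap[m]\in\mathcal{F}\}$. Then for $n\ge 7$: (i) If $7\le n\le 72$, then $W(n)=w(\mathcal{F}_7)$, and the unique left-compressed family $\mathcal{F}\subset\mathcal{P}([n])$ that is $3$-wise intersecting and $3$-intersecting with $w(\mathcal{F})=W(n)$ is $\mathcal{F}_7\times\{0,1\}^{n-7}$. (ii) If $n\ge 73$ is odd, then $W(n)=w(\mathcal{F}_n)$, and the unique such left-compressed family attaining $W(n)$ is $\mathcal{F}_n$. (iii) If $n\ge 74$ is even, then $W(n)=w(\mathcal{F}_{n-1})$, and the unique such left-compressed family attaining $W(n)$ is $\mathcal{F}_{n-1}\times\{0,1\}$.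
   Context: A family $\mathcal{F}\subset\mathcal{P}([n])$ is left-compressed if for all $1\le i<j\le n$ and every $A\in\mathcal{F}$ with $j\in A$, $i\notin A$, the set $(A\setminus\{j\})\cup\{i\}$ also belongs to $\mathcal{F}$. Note $w(\mathcal{F}_n)=\frac14+2^{-n}\left(-\frac12\binom{n-1}{(n-1)/2}+n\right)$ for odd $n\ge7$. *)

theory Defs
  imports Complex_Main
begin

text \<open>The ground set \<open>[n]\<close> is \<open>{1..n}\<close>; a family on \<open>[n]\<close> is a set \<open>F \<subseteq> Pow {1..n}\<close>.\<close>

definition left_compressed :: "nat \<Rightarrow> nat set set \<Rightarrow> bool" where
  "left_compressed n F \<longleftrightarrow>
     (\<forall>i j. 1 \<le> i \<and> i < j \<and> j \<le> n \<longrightarrow>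
        (\<forall>A\<in>F. j \<in> A \<and> i \<notin> A \<longrightarrow> (A - {j}) \<union> {i} \<in> F))"

definition three_wise_intersecting :: "nat set set \<Rightarrow> bool" where
  "three_wise_intersecting F \<longleftrightarrow> (\<forall>A\<in>F. \<forall>B\<in>F. \<forall>C\<in>F. A \<inter> B \<inter> C \<noteq> {})"

text \<open>The two members are not required to be distinct, so every member of a
  \<open>t\<close>-intersecting family has at least \<open>t\<close> elements.\<close>

definition t_intersecting :: "nat \<Rightarrow> nat set set \<Rightarrow> bool" where
  "t_intersecting t F \<longleftrightarrow> (\<forall>A\<in>F. \<forall>B\<in>F. t \<le> card (A \<inter> B))"

definition admissible :: "nat \<Rightarrow> nat set set \<Rightarrow> bool" where
  "admissible n F \<longleftrightarrow>
     F \<subseteq> Pow {1..n} \<and> three_wise_intersecting F \<and> t_intersecting 3 F"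

text \<open>The weight depends on the ground set, hence the explicit argument \<open>n\<close>.\<close>

definition weight :: "nat \<Rightarrow> nat set set \<Rightarrow> real" where
  "weight n F = real (card F) / 2 ^ n"

definition max_weight :: "nat \<Rightarrow> real" where
  "max_weight n = Max {weight n F | F. admissible n F}"

text \<open>Meant for odd \<open>n \<ge> 7\<close> only, where the division by 2 is exact and the subtraction
  does not truncate.\<close>

definition extremal_family :: "nat \<Rightarrow> nat set set" where
  "extremal_family n =
     {A. A \<subseteq> {1..n} \<and> 1 \<in> A \<and> (n + 3) div 2 \<le> card A} \<union>
     {A. A \<subseteq> {1..n} \<and> 1 \<notin> A \<and> n - 2 \<le> card A}"

text \<open>The family \<open>F \<times> {0,1}\<^sup>k\<close> on \<open>[m + k]\<close>, for \<open>F\<close> on \<open>[m]\<close>; for \<open>k = 0\<close> it is \<open>F\<close> itself.\<close>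

definition times_cube :: "nat \<Rightarrow> nat set set \<Rightarrow> nat \<Rightarrow> nat set set" where
  "times_cube m F k = {A. A \<subseteq> {1..m + k} \<and> A \<inter> {1..m} \<in> F}"

end

theory Submission
  imports Defs "HOL-Library.FuncSet"
begin

text \<open>
  Compression reduces the upper bound to left-compressed families \<open>F\<close> on \<open>[n]\<close>, and the maximum is
  compared with the one on \<open>[n - 1]\<close>. If any two members of \<open>F\<close> meet in at least two points of
  \<open>[n - 2]\<close>, give each \<open>X \<subseteq> [n - 2]\<close> the multiplicity \<open>m X \<le> 4\<close>, the number of members of \<open>F\<close> with
  trace \<open>X\<close>. For \<open>(k, l) = (4, 1)\<close> and \<open>(3, 2)\<close> the family
  \<open>{X. k \<le> m X} \<union> {X \<union> {n - 1} | X. l \<le> m X}\<close> on \<open>[n - 1]\<close> is again admissible, and the two sizes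
  add up to \<open>|F|\<close>, so the weight does not exceed the maximum for \<open>n - 1\<close>.
  Otherwise two members of \<open>F\<close> meet exactly in \<open>{1, n - 1, n}\<close>. Then no member avoids 1, \<open>n - 1\<close>
  and \<open>n\<close>, so by compression a member without 1 misses at most one further point; there are at
  most \<open>n\<close> of these. The members through 1 form a 2-intersecting family on \<open>n - 1\<close> points,
  to which Katona's theorem applies. For odd \<open>n\<close> the resulting bound is the size of the extremal
  family, for even \<open>n\<close> it is less than twice the size of the one on \<open>[n - 1]\<close>, and the change at
  \<open>n = 73\<close> comes from a comparison of central binomial coefficients.
\<close>

section \<open>Katona's theorem for compressed families\<close>

definition binomial_tail :: "nat \<Rightarrow> nat \<Rightarrow> nat" where
  "binomial_tail l j = (\<Sum>i = j..l. l choose i)"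

lemma card_large_subsets:
  assumes "finite S" "card S = l"
  shows "card {A. A \<subseteq> S \<and> j \<le> card A} = binomial_tail l j"
proof -
  have "{A. A \<subseteq> S \<and> j \<le> card A} = (\<Union>i\<in>{j..l}. {A. A \<subseteq> S \<and> card A = i})"
    using assms by (auto intro: card_mono)
  then have "card {A. A \<subseteq> S \<and> j \<le> card A} = (\<Sum>i\<in>{j..l}. card {A. A \<subseteq> S \<and> card A = i})"
    using assms by (simp add: card_UN_disjoint disjoint_iff)
  then show ?thesis
    using n_subsets[OF assms(1)] assms(2) by (simp add: binomial_tail_def)
qed

text \<open>Pascal's rule summed over the tail. It matches the split of a family into
  \<open>link\<close> and \<open>deletion\<close>, which makes it the recursion behind Katona's
  bound.\<close>

lemma binomial_tail_Suc_Suc: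
  "binomial_tail (Suc l) (Suc j) = binomial_tail l j + binomial_tail l (Suc j)"
proof (cases "j \<le> l")
  case True
  have "binomial_tail (Suc l) (Suc j) = (\<Sum>i = j..l. (l choose i) + (l choose Suc i))"
    unfolding binomial_tail_def by (subst sum.shift_bounds_cl_Suc_ivl) simp
  also have "\<dots> = binomial_tail l j + (\<Sum>i = Suc j..Suc l. l choose i)"
    unfolding binomial_tail_def by (subst sum.shift_bounds_cl_Suc_ivl) (simp add: sum.distrib)
  also have "(\<Sum>i = Suc j..Suc l. l choose i) = binomial_tail l (Suc j)"
    using True unfolding binomial_tail_def by (subst sum.nat_ivl_Suc') auto
  finally show ?thesis .
qed (simp add: binomial_tail_def)

text \<open>Complementation exchanges the sets of size at most \<open>k\<close> with those of size
  at least \<open>k + 1\<close>, so the tail counts half of all subsets.\<close>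

lemma binomial_tail_odd: "binomial_tail (2 * k + 1) (k + 1) = 4 ^ k"
proof -
  have "(\<Sum>i\<le>k. 2 * k + 1 choose i) = (\<Sum>i = k + 1..2 * k + 1. 2 * k + 1 choose i)"
    by (rule sum.reindex_bij_witness[where i = "\<lambda>i. 2 * k + 1 - i" and j = "\<lambda>i. 2 * k + 1 - i"])
      (auto simp: binomial_symmetric[symmetric])
  then have "binomial_tail (2 * k + 1) (k + 1) = 2 ^ (2 * k)"
    unfolding binomial_tail_def binomial_r_part_sum[symmetric] by (rule sym)
  then show ?thesis
    by (simp add: power_mult)
qed

text \<open>By Pascal's rule the tails of \<open>2 * k\<close> from \<open>k\<close> and from
  \<open>k + 1\<close> add up to \<open>4 ^ k\<close>, and they differ by the central
  coefficient.\<close>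

lemma binomial_tail_central: "2 * binomial_tail (2 * k) (k + 1) + (2 * k choose k) = 4 ^ k"
proof -
  have "binomial_tail (2 * k) k = (2 * k choose k) + binomial_tail (2 * k) (Suc k)"
    unfolding binomial_tail_def by (rule sum.atLeast_Suc_atMost) simp
  then show ?thesis
    using binomial_tail_odd[of k] binomial_tail_Suc_Suc[of "2 * k" k] by simp
qed

text \<open>On the ground set \<open>{a + 1..b}\<close>; \<^const>\<open>left_compressed\<close> is the case \<open>a = 0\<close>.\<close>

definition compressed_above :: "nat \<Rightarrow> nat \<Rightarrow> nat set set \<Rightarrow> bool" where
  "compressed_above a b F \<longleftrightarrow>
     (\<forall>i j A. a < i \<longrightarrow> i < j \<longrightarrow> j \<le> b \<longrightarrow> A \<in> F \<longrightarrow> j \<in> A \<longrightarrow> i \<notin> A \<longrightarrow> insert i (A - {j}) \<in> F)"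

lemma left_compressed_iff: "left_compressed n F \<longleftrightarrow> compressed_above 0 n F"
  by (auto simp: left_compressed_def compressed_above_def Suc_le_eq)

lemma compressed_aboveD:
  "\<lbrakk>compressed_above a b F; a < i; i < j; j \<le> b; A \<in> F; j \<in> A; i \<notin> A\<rbrakk> \<Longrightarrow> insert i (A - {j}) \<in> F"
  by (auto simp: compressed_above_def)

section \<open>Link and deletion at the first point\<close>

definition link :: "nat \<Rightarrow> nat set set \<Rightarrow> nat set set" where
  "link x F = {A. x \<notin> A \<and> insert x A \<in> F}"

definition deletion :: "nat \<Rightarrow> nat set set \<Rightarrow> nat set set" where
  "deletion x F = {A \<in> F. x \<notin> A}"

lemma card_link_deletion:
  assumes "finite F"
  shows "card F = card (link x F) + card (deletion x F)"
proof -
  have 1: "F = insert x ` link x F \<union> deletion x F"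
  proof (intro subset_antisym subsetI)
    fix A assume A: "A \<in> F"
    show "A \<in> insert x ` link x F \<union> deletion x F"
    proof (cases "x \<in> A")
      case True
      then have "A - {x} \<in> link x F" "A = insert x (A - {x})"
        using A by (auto simp: link_def insert_absorb)
      then show ?thesis by blast
    qed (use A in \<open>auto simp: deletion_def\<close>)
  qed (auto simp: link_def deletion_def)
  have "inj_on (insert x) (link x F)"
    by (rule inj_onI) (auto simp: link_def)
  then have "card (insert x ` link x F) = card (link x F)"
    by (rule card_image)
  moreover have "insert x ` link x F \<inter> deletion x F = {}"
    by (auto simp: deletion_def)
  moreover have "finite (insert x ` link x F)" "finite (deletion x F)"
    using 1 assms by (metis finite_Un)+
  ultimately show ?thesis
    using 1 card_Un_disjoint by metis
qed

lemma
  assumes "F \<subseteq> Pow {Suc a..b}"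
  shows link_ground: "link (Suc a) F \<subseteq> Pow {Suc (Suc a)..b}"
    and deletion_ground: "deletion (Suc a) F \<subseteq> Pow {Suc (Suc a)..b}"
proof -
  have "{Suc (Suc a)..b} = {Suc a..b} - {Suc a}" by auto
  then show "link (Suc a) F \<subseteq> Pow {Suc (Suc a)..b}" "deletion (Suc a) F \<subseteq> Pow {Suc (Suc a)..b}"
    using assms unfolding link_def deletion_def by blast+
qed

lemma
  assumes "compressed_above a b F"
  shows compressed_above_link: "compressed_above (Suc a) b (link (Suc a) F)"
    and compressed_above_deletion: "compressed_above (Suc a) b (deletion (Suc a) F)"
proof -
  show "compressed_above (Suc a) b (link (Suc a) F)"
    unfolding compressed_above_def
  proof (intro allI impI)
    fix i j A
    assume *: "Suc a < i" "i < j" "j \<le> b" "A \<in> link (Suc a) F" "j \<in> A" "i \<notin> A"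
    then have "insert i (insert (Suc a) A - {j}) \<in> F"
      by (intro compressed_aboveD[OF assms]) (auto simp: link_def)
    moreover have "insert i (insert (Suc a) A - {j}) = insert (Suc a) (insert i (A - {j}))"
      using * by auto
    ultimately show "insert i (A - {j}) \<in> link (Suc a) F"
      using * by (auto simp: link_def)
  qed
  show "compressed_above (Suc a) b (deletion (Suc a) F)"
    using assms by (auto simp: compressed_above_def deletion_def)
qed

lemma t_intersecting_link:
  assumes "t_intersecting (Suc t) F" "\<And>A. A \<in> F \<Longrightarrow> finite A"
  shows "t_intersecting t (link x F)"
  unfolding t_intersecting_def
proof (intro ballI)
  fix A B assume "A \<in> link x F" "B \<in> link x F"
  then have *: "x \<notin> A" "x \<notin> B" "insert x A \<in> F" "insert x B \<in> F"
    by (auto simp: link_def)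
  have "Suc t \<le> card (insert x A \<inter> insert x B)"
    using assms(1) * unfolding t_intersecting_def by blast
  also have "insert x A \<inter> insert x B = insert x (A \<inter> B)"
    by auto
  also have "card \<dots> = Suc (card (A \<inter> B))"
    using * assms(2)[OF *(3)] by simp
  finally show "t \<le> card (A \<inter> B)" by simp
qed

text \<open>In one of two members without the first point, compression exchanges a common point
  \<open>x\<close> for the first point. The new member meets the other in the old intersection
  without \<open>x\<close>, and this must still have \<open>t\<close> points.\<close>

lemma t_intersecting_deletion:
  assumes "t_intersecting t F" "1 \<le> t" "F \<subseteq> Pow {Suc a..b}" "compressed_above a b F"
  shows "t_intersecting (Suc t) (deletion (Suc a) F)"
  unfolding t_intersecting_def
proof (intro ballI)
  fix A B assume "A \<in> deletion (Suc a) F" "B \<in> deletion (Suc a) F"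
  then have *: "Suc a \<notin> A" "Suc a \<notin> B" "A \<in> F" "B \<in> F"
    by (auto simp: deletion_def)
  have fin: "finite (A \<inter> B)"
    using *(3) assms(3) by (meson PowD finite_Int finite_atLeastAtMost finite_subset subsetD)
  have "1 \<le> card (A \<inter> B)"
    using * assms(1,2) unfolding t_intersecting_def by (meson le_trans)
  then obtain x where x: "x \<in> A" "x \<in> B" by (cases "A \<inter> B = {}") auto
  then have "x \<in> {Suc a..b}" "x \<noteq> Suc a"
    using * assms(3) by blast+
  then have "insert (Suc a) (A - {x}) \<in> F"
    using x * by (intro compressed_aboveD[OF assms(4)]) auto
  then have "t \<le> card (insert (Suc a) (A - {x}) \<inter> B)"
    using * assms(1) unfolding t_intersecting_def by blast
  also have "insert (Suc a) (A - {x}) \<inter> B = (A \<inter> B) - {x}"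
    using * by auto
  finally show "Suc t \<le> card (A \<inter> B)"
    using x fin \<open>1 \<le> card (A \<inter> B)\<close> by (simp add: card_Diff_singleton)
qed

text \<open>No member of \<open>F\<close> is the complement of a member of \<open>G\<close>, so
  \<open>F\<close> and the complements of the members of \<open>G\<close> are disjoint parts of
  \<open>Pow S\<close>. The case \<open>F = G\<close> bounds an intersecting family by half of the
  power set.\<close>

lemma card_intersecting_le:
  assumes "finite S" "F \<subseteq> Pow S" "\<And>A B. A \<in> F \<Longrightarrow> B \<in> G \<Longrightarrow> A \<inter> B \<noteq> {}" "G \<subseteq> Pow S"
  shows "card F + card G \<le> 2 ^ card S"
proof -
  have "inj_on (\<lambda>A. S - A) G"
    using assms(4) by (intro inj_onI) blast
  then have "card ((\<lambda>A. S - A) ` G) = card G"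
    by (rule card_image)
  moreover have "F \<inter> (\<lambda>A. S - A) ` G = {}"
    using assms(3) by fastforce
  ultimately have "card F + card G = card (F \<union> (\<lambda>A. S - A) ` G)"
    using assms finite_subset[OF assms(2)] finite_subset[OF assms(4)]
    by (simp add: card_Un_disjoint)
  also have "\<dots> \<le> card (Pow S)"
    using assms by (intro card_mono) auto
  finally show ?thesis
    using assms by (simp add: card_Pow)
qed

text \<open>With \<open>l + e\<close> points, \<open>e \<le> 1\<close> makes \<open>l + t\<close> even;
  the bound obeys the same recursion as the families under link and deletion.\<close>

lemma katona_bound:
  assumes "F \<subseteq> Pow {Suc a..a + l + e}" "compressed_above a (a + l + e) F"
    "t_intersecting t F" "1 \<le> t" "t + l = 2 * j" "e \<le> 1"
  shows "card F \<le> 2 ^ e * binomial_tail l j"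
  using assms(1-5)
proof (induction l arbitrary: a F t j)
  case 0
  \<comment> \<open>For \<open>l = 0\<close> the number \<open>t\<close> is even and positive, hence
    at least 2, while the ground set has only \<open>e \<le> 1\<close> points.\<close>
  have "F = {}"
  proof (rule ccontr)
    assume "F \<noteq> {}"
    then obtain A where "A \<in> F" by auto
    then have "A \<subseteq> {Suc a..a + 0 + e}" "t \<le> card (A \<inter> A)"
      using 0 unfolding t_intersecting_def by blast+
    then have "t \<le> card {Suc a..a + 0 + e}"
      using card_mono[of "{Suc a..a + 0 + e}" A] by simp
    then show False using 0 assms(6) by simp
  qed
  then show ?case by simp
next
  case (Suc l)
  have fin: "\<And>A. A \<in> F \<Longrightarrow> finite A"
    using Suc.prems(1) by (meson PowD finite_atLeastAtMost finite_subset subsetD)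
  show ?case
  proof (cases "t = 1")
    \<comment> \<open>Taking the link would lead to \<open>t = 0\<close>. Instead, an intersecting
      family has at most half of the \<open>2 ^ (2 * k + 1 + e)\<close> subsets, which is the
      claimed bound.\<close>
    case True
    then obtain k where k: "l = 2 * k" "j = k + 1"
      using Suc.prems(5) by (cases j) auto
    have "A \<inter> B \<noteq> {}" if "A \<in> F" "B \<in> F" for A B
      using Suc.prems(3) that True unfolding t_intersecting_def by fastforce
    then have "card F + card F \<le> 2 ^ card {Suc a..a + Suc l + e}"
      using Suc.prems(1) by (intro card_intersecting_le) auto
    moreover have "(2::nat) ^ card {Suc a..a + Suc l + e} = 2 * (2 ^ e * 4 ^ k)"
      by (simp add: k power_add power_mult)
    ultimately show ?thesis
      using binomial_tail_odd[of k] k by simp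
  next
    case False
    \<comment> \<open>The link is \<open>(t - 1)\<close>-intersecting and goes with
      \<open>j - 1\<close>; the deletion is \<open>(t + 1)\<close>-intersecting and goes with the
      same \<open>j\<close>. Both keep the parity relation with \<open>l\<close> in place of
      \<open>Suc l\<close>.\<close>
    define u where "u = t - 1"
    then have u: "t = Suc u" "1 \<le> u" using False Suc.prems(4) by auto
    obtain i where i: "j = Suc i" using Suc.prems by (cases j) auto
    have "t_intersecting (Suc u) F" using Suc.prems(3) u by simp
    then have "card (link (Suc a) F) \<le> 2 ^ e * binomial_tail l i"
      using t_intersecting_link link_ground[OF Suc.prems(1)] fin
        compressed_above_link[OF Suc.prems(2)] u i Suc.prems(5)
      by (intro Suc.IH[of _ "Suc a" u]) auto
    moreover have "card (deletion (Suc a) F) \<le> 2 ^ e * binomial_tail l j"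
      using t_intersecting_deletion[OF Suc.prems(3,4,1,2)] deletion_ground[OF Suc.prems(1)]
        compressed_above_deletion[OF Suc.prems(2)] Suc.prems(5)
      by (intro Suc.IH[of _ "Suc a" "Suc t"]) auto
    moreover have "finite F" using Suc.prems(1) finite_subset by blast
    ultimately show ?thesis
      by (simp add: i binomial_tail_Suc_Suc card_link_deletion[of F "Suc a"] algebra_simps)
  qed
qed

text \<open>Equality in \<open>katona_bound\<close> forces equality for the link and for the
  deletion. Induction on the deletion alone shows that it consists of all sets of size at least
  \<open>j\<close>, and these leave no room for a smaller member. For \<open>t = 1\<close> the star
  at the first point attains the same size, hence \<open>2 \<le> t\<close>.\<close>

lemma katona_unique:
  assumes "F \<subseteq> Pow {Suc a..a + l}" "compressed_above a (a + l) F"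
    "t_intersecting t F" "2 \<le> t" "t + l = 2 * j" "card F = binomial_tail l j"
  shows "F = {A. A \<subseteq> {Suc a..a + l} \<and> j \<le> card A}"
  using assms
proof (induction l arbitrary: a F t j)
  case 0
  then have "j \<ge> 1" by auto
  then have "binomial_tail 0 j = 0" by (simp add: binomial_tail_def)
  moreover have "finite F" using 0(1) finite_subset by blast
  ultimately show ?case using 0 \<open>j \<ge> 1\<close> by auto
next
  case (Suc l)
  have fin: "\<And>A. A \<in> F \<Longrightarrow> finite A"
    using Suc.prems(1) by (meson PowD finite_atLeastAtMost finite_subset subsetD)
  have finF: "finite F" using Suc.prems(1) finite_subset by blast
  define u where "u = t - 1"
  then have u: "t = Suc u" "1 \<le> u" using Suc.prems(4) by auto
  obtain i where i: "j = Suc i" using Suc.prems by (cases j) auto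
  have "t_intersecting (Suc u) F" using Suc.prems(3) u by simp
  then have 1: "card (link (Suc a) F) \<le> 2 ^ 0 * binomial_tail l i"
    using t_intersecting_link link_ground[OF Suc.prems(1)] fin
      compressed_above_link[OF Suc.prems(2)] u i Suc.prems(5)
    by (intro katona_bound[of _ "Suc a" l 0 u]) auto
  have int: "t_intersecting (Suc t) (deletion (Suc a) F)"
    using Suc.prems by (intro t_intersecting_deletion) auto
  have 2: "card (deletion (Suc a) F) \<le> 2 ^ 0 * binomial_tail l j"
    using int deletion_ground[OF Suc.prems(1)]
      compressed_above_deletion[OF Suc.prems(2)] Suc.prems(5)
    by (intro katona_bound[of _ "Suc a" l 0 "Suc t"]) auto
  have "card (deletion (Suc a) F) = binomial_tail l j"
    using 1 2 Suc.prems(6) card_link_deletion[OF finF, of "Suc a"] i binomial_tail_Suc_Suc by simp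
  then have D: "deletion (Suc a) F = {A. A \<subseteq> {Suc (Suc a)..Suc a + l} \<and> j \<le> card A}"
    using int deletion_ground[OF Suc.prems(1)]
      compressed_above_deletion[OF Suc.prems(2)] Suc.prems(4,5)
    by (intro Suc.IH[of _ "Suc a" "Suc t"]) auto
  have "j \<le> card B" if B: "B \<in> F" for B
  proof (cases "Suc a \<in> B \<and> j \<le> l")
    case False
    then consider "Suc a \<notin> B" | "l < j" by linarith
    then show ?thesis
    proof cases
      case 1
      then have "B \<in> deletion (Suc a) F" using B by (simp add: deletion_def)
      then show ?thesis using D by auto
    next
      \<comment> \<open>From \<open>2 * j = t + l + 1\<close> and \<open>l < j\<close> follows
        \<open>j \<le> t\<close>, and \<open>t\<close> is a lower bound for the size of
        \<open>B\<close> itself.\<close>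
      case 2
      have "t \<le> card (B \<inter> B)" using B Suc.prems(3) unfolding t_intersecting_def by blast
      then show ?thesis using 2 Suc.prems(5) by simp
    qed
  next
    case True
    show ?thesis
    proof (rule ccontr)
      assume "\<not> j \<le> card B"
      \<comment> \<open>Enlarge \<open>B - {Suc a}\<close> to a set \<open>C\<close> of size
        \<open>j - 2\<close>, then choose \<open>A\<close> of size \<open>j\<close> containing
        \<open>S - C\<close>. This \<open>A\<close> is in the deletion and meets \<open>B\<close>
        only inside \<open>C\<close>, in at most \<open>j - (l - (j - 2)) = t - 1\<close>
        points.\<close>
      define S where "S = {Suc (Suc a)..Suc a + l}"
      have S: "finite S" "card S = l" by (simp_all add: S_def)
      have "B \<subseteq> insert (Suc a) S"
        using B Suc.prems(1) by (fastforce simp: S_def)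
      then have BS: "B - {Suc a} \<subseteq> S" by auto
      have "card (B - {Suc a}) \<le> j - 2"
        using \<open>\<not> j \<le> card B\<close> True fin[OF B] by simp
      moreover have "j - 2 \<le> card S"
        using S True by linarith
      ultimately obtain C where C: "B - {Suc a} \<subseteq> C" "C \<subseteq> S" "card C = j - 2"
        using exists_subset_between[of "B - {Suc a}" "j - 2" S] S BS by blast
      have cSC: "card (S - C) = l - (j - 2)"
        using C S by (simp add: card_Diff_subset finite_subset)
      have "card (S - C) \<le> j" "j \<le> card S"
        using cSC S True Suc.prems(4,5) by auto
      then obtain A where A: "S - C \<subseteq> A" "A \<subseteq> S" "card A = j"
        using exists_subset_between[of "S - C" j S] S by auto
      then have "A \<in> F" using D by (auto simp: S_def deletion_def)
      then have "t \<le> card (A \<inter> B)" using B Suc.prems(3) unfolding t_intersecting_def by blast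
      also have "\<dots> \<le> card (A - (S - C))"
        using A C S BS by (intro card_mono) (auto simp: S_def intro: finite_subset)
      also have "\<dots> = j - (l - (j - 2))"
        using A C S cSC by (simp add: card_Diff_subset)
      finally show False using Suc.prems(4,5) True by simp
    qed
  qed
  then have sub: "F \<subseteq> {A. A \<subseteq> {Suc a..a + Suc l} \<and> j \<le> card A}"
    using Suc.prems(1) by auto
  have fin': "finite {A. A \<subseteq> {Suc a..a + Suc l} \<and> j \<le> card A}"
    by (rule finite_subset[of _ "Pow {Suc a..a + Suc l}"]) auto
  have "card {A. A \<subseteq> {Suc a..a + Suc l} \<and> j \<le> card A} = binomial_tail (Suc l) j"
    by (rule card_large_subsets) auto
  then show ?case
    using card_subset_eq[OF fin' sub] Suc.prems(6) by simp
qed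

section \<open>Compression and folding\<close>

text \<open>For families of finite sets, \<open>r = 2\<close>, \<open>t = 3\<close> and
  \<open>r = 3\<close>, \<open>t = 1\<close> are the two conditions in \<open>admissible\<close>, so
  one shifting argument treats both.\<close>

definition r_wise_intersecting :: "nat \<Rightarrow> nat \<Rightarrow> nat set set \<Rightarrow> bool" where
  "r_wise_intersecting r t F \<longleftrightarrow> (\<forall>f. (\<forall>x<r. f x \<in> F) \<longrightarrow> t \<le> card (\<Inter>x<r. f x))"

text \<open>The Erdos-Ko-Rado shift. A member stays where it is if its image is already taken, which
  keeps the map injective on \<open>F\<close>.\<close>

definition shift :: "nat \<Rightarrow> nat \<Rightarrow> nat set set \<Rightarrow> nat set \<Rightarrow> nat set" where
  "shift i j F A =
     (if j \<in> A \<and> i \<notin> A \<and> insert i (A - {j}) \<notin> F then insert i (A - {j}) else A)"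

text \<open>Whether the image lies in \<open>F\<close> tells whether the set has moved, and a moved
  set is recovered by exchanging the points back.\<close>

lemma inj_on_shift: "inj_on (shift i j F) F"
proof (rule inj_onI)
  fix A B assume AB: "A \<in> F" "B \<in> F" "shift i j F A = shift i j F B"
  have moves: "insert j (shift i j F A - {i}) = A" if "shift i j F A \<notin> F" "A \<in> F" for A
  proof -
    have *: "j \<in> A \<and> i \<notin> A \<and> shift i j F A = insert i (A - {j})"
      using that unfolding shift_def by presburger
    then have "insert j (insert i (A - {j}) - {i}) = A" by blast
    then show ?thesis using * by simp
  qed
  show "A = B"
  proof (cases "shift i j F A \<in> F")
    case True
    have stays: "shift i j F C = C" if "shift i j F C \<in> F" for C
      using that unfolding shift_def by presburger
    have "shift i j F B \<in> F" using True unfolding AB(3) .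
    note stays[OF True, symmetric]
    also note AB(3)
    also note stays[OF \<open>shift i j F B \<in> F\<close>]
    finally show ?thesis .
  next
    case False
    then have "shift i j F B \<notin> F" unfolding AB(3) .
    note moves[OF False AB(1), symmetric]
    also have "insert j (shift i j F A - {i}) = insert j (shift i j F B - {i})"
      by (simp only: AB(3))
    also note moves[OF \<open>shift i j F B \<notin> F\<close> AB(2)]
    finally show ?thesis .
  qed
qed

text \<open>The sets \<open>f x\<close> are replaced by members \<open>g x\<close> of
  \<open>F\<close> whose intersection is no larger. A set outside \<open>F\<close> has moved and can
  be moved back; a set in \<open>F\<close> that contains \<open>j\<close> but not \<open>i\<close>
  stayed because its exchange is in \<open>F\<close> too.\<close>

lemma r_wise_intersecting_shift:
  assumes int: "r_wise_intersecting r t F" and fin: "\<And>A. A \<in> F \<Longrightarrow> finite A" and "i \<noteq> j" "0 < r"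
  shows "r_wise_intersecting r t (shift i j F ` F)"
  unfolding r_wise_intersecting_def
proof (intro allI impI)
  fix f assume f: "\<forall>x<r. f x \<in> shift i j F ` F"
  have moved: "i \<in> f x \<and> j \<notin> f x \<and> insert j (f x - {i}) \<in> F" if "x < r" "f x \<notin> F" for x
  proof -
    have "f x \<in> shift i j F ` F" using f that(1) by simp
    then obtain A where A: "A \<in> F" "f x = shift i j F A" by blast
    then have "j \<in> A" "i \<notin> A" "f x = insert i (A - {j})"
      using that by (auto simp: shift_def split: if_splits)
    moreover from this have "insert j (f x - {i}) = A" by auto
    ultimately show ?thesis using A \<open>i \<noteq> j\<close> by auto
  qed
  have stayed: "insert i (f x - {j}) \<in> F" if "x < r" "f x \<in> F" "j \<in> f x" "i \<notin> f x" for x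
  proof -
    have "f x \<in> shift i j F ` F" using f that(1) by simp
    then obtain A where A: "A \<in> F" "f x = shift i j F A" by blast
    then show ?thesis using that by (auto simp: shift_def split: if_splits)
  qed
  have fin_f: "finite (f x)" if "x < r" for x
    using fin[of "f x"] fin[of "insert j (f x - {i})"] moved[OF that] by (cases "f x \<in> F") auto
  have "f 0 \<supseteq> (\<Inter>x<r. f x)" using \<open>0 < r\<close> by auto
  then have fin_Int: "finite (\<Inter>x<r. f x)"
    using fin_f[OF \<open>0 < r\<close>] finite_subset by blast
  show "t \<le> card (\<Inter>x<r. f x)"
  proof (cases "\<forall>x<r. f x \<in> F")
    case True
    then show ?thesis using int unfolding r_wise_intersecting_def by blast
  next
    case False
    then obtain y where y: "y < r" "f y \<notin> F" by auto
    show ?thesis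
    proof (cases "\<forall>x<r. i \<in> f x")
      case True
      \<comment> \<open>If all the sets contain \<open>i\<close>, undo the moves only. The
        intersection loses \<open>i\<close> because \<open>f y\<close> had moved, and it gains at
        most \<open>j\<close>.\<close>
      define g where "g x = (if f x \<in> F then f x else insert j (f x - {i}))" for x
      have "\<forall>x<r. g x \<in> F" using moved by (auto simp: g_def)
      then have "t \<le> card (\<Inter>x<r. g x)" using int unfolding r_wise_intersecting_def by blast
      also have "\<dots> \<le> card (insert j ((\<Inter>x<r. f x) - {i}))"
      proof (rule card_mono)
        have "i \<notin> g y" using y \<open>i \<noteq> j\<close> by (simp add: g_def)
        moreover have "w \<in> f x" if "w \<in> g x" "w \<noteq> j" for w x
          using that by (auto simp: g_def split: if_splits)
        ultimately show "(\<Inter>x<r. g x) \<subseteq> insert j ((\<Inter>x<r. f x) - {i})"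
          using y by blast
      qed (use fin_Int in simp)
      also have "\<dots> \<le> Suc (card ((\<Inter>x<r. f x) - {i}))"
        by (rule card_insert_le_m1) auto
      also have "\<dots> = card (\<Inter>x<r. f x)"
        using True fin_Int by (intro card_Suc_Diff1) auto
      finally show ?thesis .
    next
      case False
      then obtain z where z: "z < r" "i \<notin> f z" by auto
      \<comment> \<open>If \<open>f z\<close> lacks \<open>i\<close>, also exchange \<open>j\<close>
        for \<open>i\<close> wherever the exchange was blocked. Then \<open>g y\<close> lacks
        \<open>i\<close> and \<open>g z\<close> lacks \<open>j\<close>, so neither point is in the
        intersection, and other points are unaffected.\<close>
      define g where "g x = (if f x \<notin> F then insert j (f x - {i})
        else if j \<in> f x \<and> i \<notin> f x then insert i (f x - {j}) else f x)" for x
      have "\<forall>x<r. g x \<in> F" using moved stayed by (auto simp: g_def)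
      then have "t \<le> card (\<Inter>x<r. g x)" using int unfolding r_wise_intersecting_def by blast
      also have "\<dots> \<le> card (\<Inter>x<r. f x)"
      proof (rule card_mono[OF fin_Int])
        have "i \<notin> g y" using y \<open>i \<noteq> j\<close> by (simp add: g_def)
        moreover have "j \<notin> g z" using z moved \<open>i \<noteq> j\<close> by (auto simp: g_def)
        moreover have "w \<in> f x" if "w \<in> g x" "w \<noteq> i" "w \<noteq> j" for w x
          using that by (auto simp: g_def split: if_splits)
        ultimately show "(\<Inter>x<r. g x) \<subseteq> (\<Inter>x<r. f x)"
          using y z by blast
      qed
      finally show ?thesis .
    qed
  qed
qed

lemma t_intersecting_iff_r_wise: "t_intersecting t F \<longleftrightarrow> r_wise_intersecting 2 t F"
proof
  assume F: "t_intersecting t F"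
  show "r_wise_intersecting 2 t F"
    unfolding r_wise_intersecting_def
  proof (intro allI impI)
    fix f :: "nat \<Rightarrow> nat set" assume "\<forall>x<2. f x \<in> F"
    then have "t \<le> card (f 0 \<inter> f 1)" using F unfolding t_intersecting_def by simp
    also have "f 0 \<inter> f 1 = (\<Inter>x<2. f x)" by (auto simp: numeral_2_eq_2 less_Suc_eq)
    finally show "t \<le> card (\<Inter>x<2. f x)" .
  qed
next
  assume F: "r_wise_intersecting 2 t F"
  show "t_intersecting t F"
    unfolding t_intersecting_def
  proof (intro ballI)
    fix A B assume "A \<in> F" "B \<in> F"
    define f where "f x = (if x = 0 then A else B)" for x :: nat
    have "\<forall>x<2. f x \<in> F"
      using \<open>A \<in> F\<close> \<open>B \<in> F\<close> by (simp add: f_def)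
    then have "t \<le> card (\<Inter>x<2. f x)"
      using F unfolding r_wise_intersecting_def by blast
    also have "(\<Inter>x<2. f x) = A \<inter> B"
      by (auto simp: f_def numeral_2_eq_2 less_Suc_eq split: if_splits)
    finally show "t \<le> card (A \<inter> B)" .
  qed
qed

lemma three_wise_intersecting_iff_r_wise:
  assumes "\<And>A. A \<in> F \<Longrightarrow> finite A"
  shows "three_wise_intersecting F \<longleftrightarrow> r_wise_intersecting 3 1 F"
proof
  assume F: "three_wise_intersecting F"
  show "r_wise_intersecting 3 1 F"
    unfolding r_wise_intersecting_def
  proof (intro allI impI)
    fix f :: "nat \<Rightarrow> nat set" assume f: "\<forall>x<3. f x \<in> F"
    then have "f 0 \<inter> f 1 \<inter> f 2 \<noteq> {}" using F unfolding three_wise_intersecting_def by simp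
    moreover have "finite (f 0)" using f assms by simp
    ultimately have "1 \<le> card (f 0 \<inter> f 1 \<inter> f 2)" by (simp add: Suc_le_eq card_gt_0_iff)
    also have "f 0 \<inter> f 1 \<inter> f 2 = (\<Inter>x<3. f x)"
      by (auto simp: numeral_3_eq_3 numeral_2_eq_2 less_Suc_eq)
    finally show "1 \<le> card (\<Inter>x<3. f x)" .
  qed
next
  assume F: "r_wise_intersecting 3 1 F"
  show "three_wise_intersecting F"
    unfolding three_wise_intersecting_def
  proof (intro ballI)
    fix A B C assume "A \<in> F" "B \<in> F" "C \<in> F"
    define f where "f x = (if x = 0 then A else if x = 1 then B else C)" for x :: nat
    have "\<forall>x<3. f x \<in> F"
      using \<open>A \<in> F\<close> \<open>B \<in> F\<close> \<open>C \<in> F\<close> by (simp add: f_def)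
    then have "1 \<le> card (\<Inter>x<3. f x)"
      using F unfolding r_wise_intersecting_def by blast
    also have "(\<Inter>x<3. f x) = A \<inter> B \<inter> C"
      by (auto simp: f_def numeral_3_eq_3 numeral_2_eq_2 less_Suc_eq split: if_splits)
    finally show "A \<inter> B \<inter> C \<noteq> {}" by (metis card.empty not_one_le_zero)
  qed
qed

section \<open>Compression of admissible families\<close>

lemma admissible_finite: "admissible n F \<Longrightarrow> finite F"
  unfolding admissible_def using finite_subset by blast

lemma admissible_finite_member: "admissible n F \<Longrightarrow> A \<in> F \<Longrightarrow> finite A"
  unfolding admissible_def by (meson PowD finite_atLeastAtMost finite_subset subsetD)

lemma admissible_shift:
  assumes "admissible n F" "1 \<le> i" "i < j" "j \<le> n"
  shows "admissible n (shift i j F ` F)"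
proof -
  have fin: "\<And>A. A \<in> F \<Longrightarrow> finite A" using admissible_finite_member[OF assms(1)] .
  moreover from this have "\<And>A. A \<in> shift i j F ` F \<Longrightarrow> finite A"
    by (auto simp: shift_def split: if_splits)
  moreover have "shift i j F ` F \<subseteq> Pow {1..n}"
  proof -
    have "i \<in> {1..n}" using assms by simp
    moreover have "F \<subseteq> Pow {1..n}" using assms(1) by (simp add: admissible_def)
    ultimately show ?thesis unfolding shift_def by auto
  qed
  ultimately show ?thesis
    using assms r_wise_intersecting_shift[of _ _ F i j]
    by (simp add: admissible_def t_intersecting_iff_r_wise three_wise_intersecting_iff_r_wise)
qed

text \<open>A shift that moves some member keeps the size of the family and strictly decreases the
  sum of all elements of its members, so repeated shifting terminates.\<close>

lemma ex_left_compressed: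
  assumes "admissible n F"
  shows "\<exists>F'. admissible n F' \<and> left_compressed n F' \<and> card F' = card F"
  using assms
proof (induction "\<Sum>A\<in>F. \<Sum>A" arbitrary: F rule: less_induct)
  case less
  show ?case
  proof (cases "left_compressed n F")
    case False
    then obtain i j A where A: "1 \<le> i" "i < j" "j \<le> n" "A \<in> F" "j \<in> A" "i \<notin> A"
        "insert i (A - {j}) \<notin> F"
      unfolding left_compressed_def by auto
    have *: "(\<Sum>x\<in>insert i (B - {j}). x) < (\<Sum>x\<in>B. x)" if "j \<in> B" "i \<notin> B" "B \<in> F" for B
      using that A(2) admissible_finite_member[OF less.prems, of B] by (simp add: sum.remove[of B j])
    have "(\<Sum>B\<in>shift i j F ` F. \<Sum>B) = (\<Sum>B\<in>F. \<Sum>(shift i j F B))"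
      by (simp add: sum.reindex[OF inj_on_shift])
    also have "\<dots> < (\<Sum>B\<in>F. \<Sum>B)"
    proof (rule sum_strict_mono_ex1)
      show "finite F" using less.prems by (rule admissible_finite)
      show "\<forall>B\<in>F. \<Sum>(shift i j F B) \<le> \<Sum>B"
        using * by (simp add: shift_def less_imp_le)
      have "shift i j F A = insert i (A - {j})"
        unfolding shift_def by (rule if_P) (use A in blast)
      then have "\<Sum>(shift i j F A) < \<Sum>A"
        using *[OF A(5,6,4)] by (simp only:)
      then show "\<exists>B\<in>F. \<Sum>(shift i j F B) < \<Sum>B"
        using A(4) by blast
    qed
    finally show ?thesis
      using less.hyps[of "shift i j F ` F"] admissible_shift[OF less.prems A(1-3)]
      by (simp add: card_image[OF inj_on_shift])
  qed (use less.prems in blast)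
qed

section \<open>Folding the points \<open>q + 1\<close> and \<open>q + 2\<close> into one\<close>

definition tails :: "nat \<Rightarrow> nat set set \<Rightarrow> nat set \<Rightarrow> nat set set" where
  "tails q F X = {T. T \<subseteq> {Suc q, Suc (Suc q)} \<and> X \<union> T \<in> F}"

definition heavy :: "nat \<Rightarrow> nat set set \<Rightarrow> nat \<Rightarrow> nat set set" where
  "heavy q F k = {X. X \<subseteq> {1..q} \<and> k \<le> card (tails q F X)}"

definition fold_family :: "nat \<Rightarrow> nat set set \<Rightarrow> nat \<Rightarrow> nat \<Rightarrow> nat set set" where
  "fold_family q F k l = heavy q F k \<union> insert (Suc q) ` heavy q F l"

lemma tails_Pow: "tails q F X \<subseteq> Pow {Suc q, Suc (Suc q)}"
  by (auto simp: tails_def)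

lemma finite_tails: "finite (tails q F X)"
  by (rule finite_subset[OF tails_Pow]) simp

lemma card_tails_le: "card (tails q F X) \<le> 4"
  using card_mono[OF _ tails_Pow, of q F X] by (simp add: card_Pow)

lemma heavy_antimono: "l \<le> k \<Longrightarrow> heavy q F k \<subseteq> heavy q F l"
  by (auto simp: heavy_def)

lemma finite_heavy: "finite (heavy q F k)"
  by (rule finite_subset[of _ "Pow {1..q}"]) (auto simp: heavy_def)

lemma heavy_tail: "X \<in> heavy q F k \<Longrightarrow> 1 \<le> k \<Longrightarrow> \<exists>T. T \<in> tails q F X"
  unfolding heavy_def using card_eq_0_iff[of "tails q F X"] by fastforce

text \<open>Count the members by their traces on \<open>[q]\<close>, write each multiplicity as the
  number of thresholds \<open>k\<close> in \<open>{1..4}\<close> that it reaches, and exchange the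
  two sums.\<close>

lemma card_family_eq_sum_heavy:
  assumes "F \<subseteq> Pow {1..Suc (Suc q)}"
  shows "card F = (\<Sum>k = 1..4. card (heavy q F k))"
proof -
  let ?P = "Pow {1..q}" and ?W = "{Suc q, Suc (Suc q)}"
  have "bij_betw (\<lambda>(X, T). X \<union> T) (SIGMA X:?P. tails q F X) F"
  proof (rule bij_betwI[where g = "\<lambda>A. (A \<inter> {1..q}, A \<inter> ?W)"])
    have "A \<inter> {1..q} \<union> A \<inter> ?W = A" if "A \<in> F" for A
    proof -
      have "A \<subseteq> {1..Suc (Suc q)}" using assms that by auto
      then show ?thesis by (force simp: le_Suc_eq)
    qed
    then show "(\<lambda>A. (A \<inter> {1..q}, A \<inter> ?W)) \<in> F \<rightarrow> (SIGMA X:?P. tails q F X)"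
      "\<And>A. A \<in> F \<Longrightarrow> (case (A \<inter> {1..q}, A \<inter> ?W) of (X, T) \<Rightarrow> X \<union> T) = A"
      by (auto simp: tails_def)
    show "(\<lambda>(X, T). X \<union> T) \<in> (SIGMA X:?P. tails q F X) \<rightarrow> F"
      by (auto simp: tails_def)
    show "((case p of (X, T) \<Rightarrow> X \<union> T) \<inter> {1..q}, (case p of (X, T) \<Rightarrow> X \<union> T) \<inter> ?W) = p"
      if "p \<in> (SIGMA X:?P. tails q F X)" for p
      using that by (force simp: tails_def)
  qed
  then have "card F = card (SIGMA X:?P. tails q F X)"
    by (simp add: bij_betw_same_card)
  also have "\<dots> = (\<Sum>X\<in>?P. card (tails q F X))"
    by (rule card_SigmaI) (auto simp: finite_tails)
  also have "\<dots> = (\<Sum>X\<in>?P. \<Sum>k = 1..4. of_bool (k \<le> card (tails q F X)))"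
  proof (rule sum.cong[OF refl])
    fix X
    have "{1..4} \<inter> {k. k \<le> card (tails q F X)} = {1..card (tails q F X)}"
      using card_tails_le[of q F X] by auto
    then show "card (tails q F X) = (\<Sum>k = 1..4. of_bool (k \<le> card (tails q F X)))"
      by (simp add: of_bool_def sum.inter_filter[symmetric] Int_def)
  qed
  also have "\<dots> = (\<Sum>k = 1..4. \<Sum>X\<in>?P. of_bool (k \<le> card (tails q F X)))"
    by (rule sum.swap)
  also have "\<dots> = (\<Sum>k = 1..4. card (heavy q F k))"
  proof (rule sum.cong[OF refl])
    fix k
    have "?P \<inter> {X. k \<le> card (tails q F X)} = heavy q F k"
      by (auto simp: heavy_def)
    then show "(\<Sum>X\<in>?P. of_bool (k \<le> card (tails q F X))) = card (heavy q F k)"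
      by (simp add: of_bool_def sum.inter_filter[symmetric] Int_def)
  qed
  finally show ?thesis .
qed

lemma card_fold_family: "card (fold_family q F k l) = card (heavy q F k) + card (heavy q F l)"
proof -
  have notin: "Suc q \<notin> X" if "X \<in> heavy q F m" for X m
    using that by (auto simp: heavy_def)
  then have "inj_on (insert (Suc q)) (heavy q F l)"
    by (intro inj_onI) (metis insert_ident)
  then show ?thesis
    unfolding fold_family_def using notin
    by (subst card_Un_disjoint) (auto simp: finite_heavy card_image)
qed

lemma card_family_eq_fold_families:
  assumes "F \<subseteq> Pow {1..Suc (Suc q)}"
  shows "card F = card (fold_family q F 4 1) + card (fold_family q F 3 2)"
proof -
  have "{1..4} = {1, 2, 3, 4 :: nat}" by auto
  then show ?thesis
    by (simp add: card_family_eq_sum_heavy[OF assms] card_fold_family)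
qed

text \<open>Two cross-intersecting families on the two points \<open>q + 1\<close>, \<open>q + 2\<close> have at most four members
  together, so traces of total multiplicity five extend by disjoint tails.\<close>

lemma heavy_disjoint_tails:
  assumes "X \<in> heavy q F k" "Y \<in> heavy q F l" "5 \<le> k + l"
  obtains T R where "T \<in> tails q F X" "R \<in> tails q F Y" "T \<inter> R = {}"
proof (rule ccontr)
  assume "\<not> thesis"
  then have "\<And>T R. T \<in> tails q F X \<Longrightarrow> R \<in> tails q F Y \<Longrightarrow> T \<inter> R \<noteq> {}"
    using that by blast
  then have "card (tails q F X) + card (tails q F Y) \<le> 2 ^ card {Suc q, Suc (Suc q)}"
    by (intro card_intersecting_le) (auto simp: tails_Pow)
  then show False using assms by (simp add: heavy_def)
qed

text \<open>Extend \<open>X\<close> and \<open>Y\<close> by disjoint tails and \<open>Z\<close> by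
  any tail. The point common to these three members cannot lie in the tails, so it lies in
  \<open>[q]\<close>.\<close>

lemma heavy_three_wise:
  assumes "three_wise_intersecting F" "X \<in> heavy q F k" "Y \<in> heavy q F l" "5 \<le> k + l"
    "Z \<in> heavy q F 1"
  shows "X \<inter> Y \<inter> Z \<noteq> {}"
proof -
  obtain T R where T: "T \<in> tails q F X" "R \<in> tails q F Y" "T \<inter> R = {}"
    using heavy_disjoint_tails assms by blast
  obtain Q where Q: "Q \<in> tails q F Z" using heavy_tail assms by blast
  have "(X \<union> T) \<inter> (Y \<union> R) \<inter> (Z \<union> Q) \<noteq> {}"
    using assms(1) T Q unfolding three_wise_intersecting_def tails_def by blast
  moreover have "X \<subseteq> {1..q}" "Y \<subseteq> {1..q}" "Z \<subseteq> {1..q}"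
    using assms by (auto simp: heavy_def)
  moreover have "T \<subseteq> {Suc q, Suc (Suc q)}" "R \<subseteq> {Suc q, Suc (Suc q)}" "Q \<subseteq> {Suc q, Suc (Suc q)}"
    using T Q by (auto simp: tails_def)
  moreover have "{1..q} \<inter> {Suc q, Suc (Suc q)} = {}" by auto
  ultimately show ?thesis using T(3) by blast
qed

lemma heavy_t_intersecting:
  assumes "t_intersecting t F" "X \<in> heavy q F k" "Y \<in> heavy q F l" "5 \<le> k + l"
  shows "t \<le> card (X \<inter> Y)"
proof -
  obtain T R where T: "T \<in> tails q F X" "R \<in> tails q F Y" "T \<inter> R = {}"
    using heavy_disjoint_tails assms by blast
  have "t \<le> card ((X \<union> T) \<inter> (Y \<union> R))"
    using assms(1) T unfolding t_intersecting_def tails_def by blast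
  moreover have "X \<subseteq> {1..q}" "Y \<subseteq> {1..q}"
    using assms by (auto simp: heavy_def)
  moreover have "T \<subseteq> {Suc q, Suc (Suc q)}" "R \<subseteq> {Suc q, Suc (Suc q)}"
    using T by (auto simp: tails_def)
  moreover have "{1..q} \<inter> {Suc q, Suc (Suc q)} = {}" by auto
  ultimately have "(X \<union> T) \<inter> (Y \<union> R) = X \<inter> Y" using T(3) by blast
  then show ?thesis using \<open>t \<le> card ((X \<union> T) \<inter> (Y \<union> R))\<close> by simp
qed

text \<open>If one of the sets avoids \<open>q + 1\<close>, its trace has multiplicity at least
  \<open>k\<close> and every other trace at least \<open>l\<close>, so \<open>k + l = 5\<close>
  gives the intersections already in \<open>[q]\<close>. If all contain \<open>q + 1\<close>, this
  point settles the 3-wise condition.\<close>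

lemma admissible_fold_family:
  assumes F: "admissible (Suc (Suc q)) F"
    and red: "\<And>A B. A \<in> F \<Longrightarrow> B \<in> F \<Longrightarrow> 2 \<le> card (A \<inter> B \<inter> {1..q})"
    and kl: "k + l = 5" "1 \<le> l" "l \<le> k"
  shows "admissible (Suc q) (fold_family q F k l)"
proof -
  let ?G = "fold_family q F k l"
  have three: "three_wise_intersecting F" and t3: "t_intersecting 3 F"
    using F by (auto simp: admissible_def)
  have trace: "A \<inter> {1..q} \<in> heavy q F l" "Suc q \<notin> A \<Longrightarrow> A \<inter> {1..q} \<in> heavy q F k" if "A \<in> ?G" for A
  proof -
    have "\<And>X. X \<subseteq> {1..q} \<Longrightarrow> insert (Suc q) X \<inter> {1..q} = X" by auto
    then show "A \<inter> {1..q} \<in> heavy q F l" "Suc q \<notin> A \<Longrightarrow> A \<inter> {1..q} \<in> heavy q F k"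
      using that heavy_antimono[OF kl(3), of q F]
      unfolding fold_family_def by (auto simp: heavy_def Int_absorb2)
  qed
  have trace1: "A \<inter> {1..q} \<in> heavy q F 1" if "A \<in> ?G" for A
    using trace(1)[OF that] heavy_antimono[OF kl(2)] by blast
  have "heavy q F m \<subseteq> Pow {1..q}" for m
    by (auto simp: heavy_def)
  moreover have "{1..q} \<subseteq> {1..Suc q}" "Suc q \<in> {1..Suc q}"
    by auto
  ultimately have "?G \<subseteq> Pow {1..Suc q}"
    unfolding fold_family_def by blast
  moreover have "three_wise_intersecting ?G"
    unfolding three_wise_intersecting_def
  proof (intro ballI)
    fix A B C assume ABC: "A \<in> ?G" "B \<in> ?G" "C \<in> ?G"
    have *: "A \<inter> B \<inter> C \<noteq> {}" if "A \<in> ?G" "B \<in> ?G" "C \<in> ?G" "Suc q \<notin> A" for A B C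
      using heavy_three_wise[OF three trace(2)[OF that(1,4)] trace(1)[OF that(2)] _ trace1[OF that(3)]] kl
      by auto
    show "A \<inter> B \<inter> C \<noteq> {}"
    proof (cases "Suc q \<in> A \<and> Suc q \<in> B \<and> Suc q \<in> C")
      case False
      then show ?thesis using *[of A B C] *[of B A C] *[of C A B] ABC by blast
    qed blast
  qed
  moreover have "t_intersecting 3 ?G"
    unfolding t_intersecting_def
  proof (intro ballI)
    fix A B assume AB: "A \<in> ?G" "B \<in> ?G"
    have fin: "finite A" "finite B"
      using \<open>?G \<subseteq> Pow {1..Suc q}\<close> AB by (meson PowD finite_atLeastAtMost finite_subset subsetD)+
    have *: "3 \<le> card (A \<inter> B)" if "A \<in> ?G" "B \<in> ?G" "Suc q \<notin> A" "finite A" for A B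
    proof -
      have "3 \<le> card (A \<inter> {1..q} \<inter> (B \<inter> {1..q}))"
        using heavy_t_intersecting[OF t3 trace(2)[OF that(1,3)] trace(1)[OF that(2)]] kl by simp
      also have "\<dots> \<le> card (A \<inter> B)"
        using that(4) by (intro card_mono) auto
      finally show ?thesis .
    qed
    show "3 \<le> card (A \<inter> B)"
    proof (cases "Suc q \<in> A \<and> Suc q \<in> B")
      case False
      then show ?thesis using *[of A B] *[of B A] AB fin by (auto simp: Int_commute)
    next
      case True
      \<comment> \<open>Any tails give members of \<open>F\<close> with these traces. By
        \<open>red\<close> they share two points of \<open>[q]\<close>, and \<open>q + 1\<close> is
        the third common point.\<close>
      obtain T R where T: "T \<in> tails q F (A \<inter> {1..q})" "R \<in> tails q F (B \<inter> {1..q})"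
        using heavy_tail[OF trace1[OF AB(1)]] heavy_tail[OF trace1[OF AB(2)]] by auto
      have "2 \<le> card ((A \<inter> {1..q} \<union> T) \<inter> (B \<inter> {1..q} \<union> R) \<inter> {1..q})"
        using T by (intro red) (auto simp: tails_def)
      also have "(A \<inter> {1..q} \<union> T) \<inter> (B \<inter> {1..q} \<union> R) \<inter> {1..q} = A \<inter> B \<inter> {1..q}"
      proof -
        have "T \<inter> {1..q} = {}" "R \<inter> {1..q} = {}" using T by (auto simp: tails_def)
        then show ?thesis by blast
      qed
      finally have "3 \<le> card (insert (Suc q) (A \<inter> B \<inter> {1..q}))" by simp
      also have "\<dots> \<le> card (A \<inter> B)"
        using True fin by (intro card_mono) auto
      finally show ?thesis .
    qed
  qed
  ultimately show ?thesis by (simp add: admissible_def)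
qed

section \<open>The irreducible case\<close>

lemma left_compressedD:
  "\<lbrakk>left_compressed n F; 1 \<le> i; i < j; j \<le> n; A \<in> F; j \<in> A; i \<notin> A\<rbrakk> \<Longrightarrow> insert i (A - {j}) \<in> F"
  by (auto simp: left_compressed_def)

text \<open>An intersection of at least three points with fewer than two in \<open>[q]\<close> is
  \<open>{a, q + 1, q + 2}\<close>. If just one of the sets contains 1, compression exchanges
  \<open>a\<close> for 1 in the other.\<close>

lemma irreducible_witness:
  assumes F: "admissible (Suc (Suc q)) F" "left_compressed (Suc (Suc q)) F"
    and AB: "A \<in> F" "B \<in> F" "card (A \<inter> B \<inter> {1..q}) < 2"
  obtains A' B' where "A' \<in> F" "B' \<in> F" "A' \<inter> B' = {1, Suc q, Suc (Suc q)}" "1 \<le> q"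
proof -
  let ?W = "{Suc q, Suc (Suc q)}"
  have t3: "3 \<le> card (A \<inter> B)" if "A \<in> F" "B \<in> F" for A B
    using F(1) that by (auto simp: admissible_def t_intersecting_def)
  have "A \<subseteq> {1..Suc (Suc q)}" using F(1) AB by (auto simp: admissible_def)
  then have split: "A \<inter> B = (A \<inter> B \<inter> {1..q}) \<union> (A \<inter> B \<inter> ?W)"
    by (force simp: le_Suc_eq)
  then have "3 \<le> card (A \<inter> B \<inter> {1..q}) + card (A \<inter> B \<inter> ?W)"
    using t3[OF AB(1,2)] card_Un_le[of "A \<inter> B \<inter> {1..q}" "A \<inter> B \<inter> ?W"] by simp
  moreover have "card (A \<inter> B \<inter> ?W) \<le> card ?W" by (intro card_mono) auto
  ultimately have "card (A \<inter> B \<inter> {1..q}) = 1" and "card (A \<inter> B \<inter> ?W) = card ?W"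
    using AB(3) by auto
  then obtain a where a: "A \<inter> B \<inter> {1..q} = {a}" and W: "A \<inter> B \<inter> ?W = ?W"
    using card_subset_eq[of ?W "A \<inter> B \<inter> ?W"] by (auto simp: card_1_singleton_iff)
  have a': "A \<inter> B = {a, Suc q, Suc (Suc q)}" "a \<in> {1..q}"
    using split a W by blast+
  have compress: "insert 1 (C - {a}) \<in> F" if "C \<in> F" "a \<in> C" "1 \<notin> C" for C
  proof (rule left_compressedD[OF F(2)])
    show "1 < a" using a' that by (cases "a = 1") auto
    show "a \<le> Suc (Suc q)" using a' by simp
  qed (use that in auto)
  have aAB: "a \<in> A" "a \<in> B" "a \<noteq> Suc q" "a \<noteq> Suc (Suc q)" "1 \<le> q"
    using a' by auto
  have "a = 1" if "1 \<in> A" "1 \<in> B"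
  proof -
    have "1 \<in> {a, Suc q, Suc (Suc q)}" using that a'(1) by blast
    then show ?thesis using aAB by auto
  qed
  then consider "a = 1" | "1 \<notin> A" "1 \<in> B" | "1 \<in> A" "1 \<notin> B" | "1 \<notin> A" "1 \<notin> B"
    by blast
  then show ?thesis
  proof cases
    case 1
    then show ?thesis using that[OF AB(1,2)] a' aAB by simp
  next
    case 2
    then have "insert 1 (A - {a}) \<inter> B = insert 1 (A \<inter> B - {a})" by blast
    also have "\<dots> = {1, Suc q, Suc (Suc q)}" unfolding a'(1) using aAB by auto
    finally have "insert 1 (A - {a}) \<inter> B = {1, Suc q, Suc (Suc q)}" .
    then show ?thesis using that[OF compress[OF AB(1)] AB(2)] 2 aAB by blast
  next
    case 3
    then have "A \<inter> insert 1 (B - {a}) = insert 1 (A \<inter> B - {a})" by blast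
    also have "\<dots> = {1, Suc q, Suc (Suc q)}" unfolding a'(1) using aAB by auto
    finally have "A \<inter> insert 1 (B - {a}) = {1, Suc q, Suc (Suc q)}" .
    then show ?thesis using that[OF AB(1) compress[OF AB(2)]] 3 aAB by blast
  next
    \<comment> \<open>If both sets avoid 1, the exchange in one of them destroys the common point
      \<open>a\<close> without creating another, and only two common points remain.\<close>
    case 4
    then have "insert 1 (A - {a}) \<inter> B = A \<inter> B - {a}" by blast
    also have "\<dots> = ?W" unfolding a'(1) using aAB by auto
    finally have "card (insert 1 (A - {a}) \<inter> B) = 2" by simp
    then show ?thesis
      using t3[OF compress[OF AB(1)] AB(2)] 4 aAB by simp
  qed
qed

text \<open>A smaller member avoiding 1 could be compressed until it also avoids
  \<open>q + 1\<close> and \<open>q + 2\<close>; it would then miss the intersection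
  \<open>{1, q + 1, q + 2}\<close> of two other members.\<close>

lemma irreducible_large:
  assumes F: "admissible (Suc (Suc q)) F" "left_compressed (Suc (Suc q)) F"
    and AB: "A \<in> F" "B \<in> F" "card (A \<inter> B \<inter> {1..q}) < 2"
    and Z: "Z \<in> F" "1 \<notin> Z"
  shows "q \<le> card Z"
proof (rule ccontr)
  assume small: "\<not> q \<le> card Z"
  obtain A' B' where AB': "A' \<in> F" "B' \<in> F" "A' \<inter> B' = {1, Suc q, Suc (Suc q)}" "1 \<le> q"
    using irreducible_witness[OF F AB] .
  text \<open>A member with at least two gaps above 1 can be pushed off \<open>{q + 1, q + 2}\<close>.\<close>
  have push: "\<exists>Z'\<in>F. 1 \<notin> Z' \<and> card Z' = card Z \<and> Z' \<inter> {Suc q, Suc (Suc q)} \<subseteq> Z \<inter> {Suc q, Suc (Suc q)} - {x}"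
    if Z: "Z \<in> F" "1 \<notin> Z" "card Z < q" and x: "x \<in> {Suc q, Suc (Suc q)}" for Z x
  proof (cases "x \<in> Z")
    case True
    have fin: "finite Z" using admissible_finite_member[OF F(1) Z(1)] .
    \<comment> \<open>Fewer than \<open>q - 1\<close> points of \<open>Z\<close> remain besides
      \<open>x\<close>, so some \<open>c\<close> in \<open>{2..q}\<close> is free to receive
      \<open>x\<close>; starting at 2 keeps 1 out of the set.\<close>
    have "card (Z - {x}) < card {2..q}"
    proof -
      have "card (Z - {x}) = card Z - 1" "0 < card Z"
        using True fin by (auto simp: card_gt_0_iff)
      then show ?thesis using Z(3) by simp
    qed
    then obtain c where c: "c \<in> {2..q}" "c \<notin> Z - {x}"
    proof -
      have "\<not> {2..q} \<subseteq> Z - {x}"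
        using \<open>card (Z - {x}) < card {2..q}\<close> card_mono[of "Z - {x}" "{2..q}"] fin by auto
      then show ?thesis using that by blast
    qed
    then have "c \<notin> Z" using x by auto
    have "insert c (Z - {x}) \<in> F"
      using c x True \<open>c \<notin> Z\<close> Z by (intro left_compressedD[OF F(2)]) auto
    moreover have "1 \<notin> insert c (Z - {x})" using c Z by auto
    moreover have "card (insert c (Z - {x})) = card Z"
      using \<open>c \<notin> Z\<close> fin card_Suc_Diff1[OF fin True] by simp
    moreover have "insert c (Z - {x}) \<inter> {Suc q, Suc (Suc q)} \<subseteq> Z \<inter> {Suc q, Suc (Suc q)} - {x}"
      using c by auto
    ultimately show ?thesis by (intro bexI[of _ "insert c (Z - {x})"] conjI)
  next
    case False
    then show ?thesis using Z by blast
  qed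
  obtain Z1 where Z1: "Z1 \<in> F" "1 \<notin> Z1" "card Z1 < q"
      "Z1 \<inter> {Suc q, Suc (Suc q)} \<subseteq> Z \<inter> {Suc q, Suc (Suc q)} - {Suc q}"
  proof -
    have "card Z < q" using small by simp
    from push[OF Z this, of "Suc q"] obtain Z' where
      "Z' \<in> F" "1 \<notin> Z'" "card Z' = card Z"
      "Z' \<inter> {Suc q, Suc (Suc q)} \<subseteq> Z \<inter> {Suc q, Suc (Suc q)} - {Suc q}"
      by blast
    then show ?thesis using that[of Z'] \<open>card Z < q\<close> by simp
  qed
  obtain Z2 where Z2: "Z2 \<in> F" "1 \<notin> Z2"
      "Z2 \<inter> {Suc q, Suc (Suc q)} \<subseteq> Z1 \<inter> {Suc q, Suc (Suc q)} - {Suc (Suc q)}"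
    using push[OF Z1(1-3), of "Suc (Suc q)"] by blast
  have "Z2 \<inter> {Suc q, Suc (Suc q)} = {}"
    using Z1(4) Z2(3) by blast
  then have "A' \<inter> B' \<inter> Z2 = {}"
    unfolding AB'(3) using Z2(2) by auto
  then show False
    using F(1) AB'(1,2) Z2(1) unfolding admissible_def three_wise_intersecting_def by blast
qed

lemma binomial_tail_pred: "binomial_tail (Suc m) m = m + 2"
  by (simp add: binomial_tail_def numeral_2_eq_2 atLeastAtMostSuc_conv)

lemma card_deletion_large:
  assumes "F \<subseteq> Pow {1..Suc (Suc q)}" "\<And>Z. Z \<in> F \<Longrightarrow> 1 \<notin> Z \<Longrightarrow> q \<le> card Z"
  shows "card (deletion 1 F) \<le> q + 2"
    and "card (deletion 1 F) = q + 2 \<Longrightarrow> deletion 1 F = {Z. Z \<subseteq> {2..Suc (Suc q)} \<and> q \<le> card Z}"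
proof -
  let ?D = "{Z. Z \<subseteq> {2..Suc (Suc q)} \<and> q \<le> card Z}"
  have sub: "deletion 1 F \<subseteq> ?D"
    using deletion_ground[of F 0] assms by (auto simp: deletion_def numeral_2_eq_2)
  have "card ?D = binomial_tail (Suc q) q"
    by (rule card_large_subsets) auto
  then have card: "card ?D = q + 2" by (simp add: binomial_tail_pred)
  then have fin: "finite ?D" using card_ge_0_finite by force
  show "card (deletion 1 F) \<le> q + 2" using card_mono[OF fin sub] card by simp
  show "card (deletion 1 F) = q + 2 \<Longrightarrow> deletion 1 F = ?D"
    using card_subset_eq[OF fin sub] card by simp
qed

section \<open>Counting the members through 1 and those avoiding 1\<close>

lemma
  assumes F: "admissible n F" "left_compressed n F"
  shows link_1_ground: "link 1 F \<subseteq> Pow {2..n}"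
    and link_1_compressed: "compressed_above 1 n (link 1 F)"
    and link_1_t_intersecting: "t_intersecting 2 (link 1 F)"
proof -
  have "F \<subseteq> Pow {Suc 0..n}" using F(1) by (simp add: admissible_def)
  then show "link 1 F \<subseteq> Pow {2..n}" using link_ground by (simp add: numeral_2_eq_2)
  show "compressed_above 1 n (link 1 F)"
    using compressed_above_link F(2) left_compressed_iff by simp
  have "t_intersecting (Suc 2) F" using F(1) by (simp add: admissible_def)
  then show "t_intersecting 2 (link 1 F)"
    by (rule t_intersecting_link) (rule admissible_finite_member[OF F(1)])
qed

lemma family_eqI:
  assumes "link x F = link x G" "deletion x F = deletion x G"
  shows "F = G"
proof (rule set_eqI)
  fix A
  show "A \<in> F \<longleftrightarrow> A \<in> G"
  proof (cases "x \<in> A")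
    case True
    then have *: "A \<in> H \<longleftrightarrow> A - {x} \<in> link x H" for H
      by (simp add: link_def insert_absorb)
    show ?thesis unfolding *[of F] *[of G] assms(1) ..
  next
    case False
    then have *: "A \<in> H \<longleftrightarrow> A \<in> deletion x H" for H
      by (simp add: deletion_def)
    show ?thesis unfolding *[of F] *[of G] assms(2) ..
  qed
qed

text \<open>For \<open>n = 2 * k + 1\<close> the thresholds are \<open>k + 2\<close>, counting the
  point 1, and \<open>2 * k - 1\<close>. The link is thus Katona's extremal family for
  \<open>t = 2\<close> on \<open>2 * k\<close> points, and the deletion is the largest one that
  \<open>irreducible_large\<close> permits.\<close>

lemma
  assumes "1 \<le> k"
  shows link_extremal_family:
      "link 1 (extremal_family (2 * k + 1)) = {A. A \<subseteq> {2..2 * k + 1} \<and> k + 1 \<le> card A}"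
    and deletion_extremal_family:
      "deletion 1 (extremal_family (2 * k + 1)) = {A. A \<subseteq> {2..2 * k + 1} \<and> 2 * k - 1 \<le> card A}"
proof -
  let ?n = "2 * k + 1"
  have sub: "A \<subseteq> {2..?n} \<longleftrightarrow> 1 \<notin> A \<and> A \<subseteq> {1..?n}" for A
  proof -
    have "{2..?n} = {1..?n} - {1}" by auto
    then show ?thesis by blast
  qed
  have card: "A \<subseteq> {2..?n} \<Longrightarrow> card (insert 1 A) = Suc (card A)" for A
    using finite_subset[of A "{2..?n}"] by (subst card_insert_disjoint) auto
  have "insert 1 A \<subseteq> {1..?n} \<longleftrightarrow> A \<subseteq> {1..?n}" for A by simp
  then have "A \<in> link 1 (extremal_family ?n) \<longleftrightarrow> A \<subseteq> {2..?n} \<and> k + 2 \<le> card (insert 1 A)" for A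
    unfolding link_def extremal_family_def sub by simp
  then show "link 1 (extremal_family ?n) = {A. A \<subseteq> {2..?n} \<and> k + 1 \<le> card A}"
    using card by auto
  show "deletion 1 (extremal_family ?n) = {A. A \<subseteq> {2..?n} \<and> 2 * k - 1 \<le> card A}"
    unfolding deletion_def extremal_family_def sub by auto
qed

lemma card_extremal_family:
  assumes "1 \<le> k"
  shows "card (extremal_family (2 * k + 1)) = binomial_tail (2 * k) (k + 1) + 2 * k + 1"
proof -
  have "finite (extremal_family (2 * k + 1))"
    by (rule finite_subset[of _ "Pow {1..2 * k + 1}"]) (auto simp: extremal_family_def)
  moreover have "card {A. A \<subseteq> {2..2 * k + 1} \<and> k + 1 \<le> card A} = binomial_tail (2 * k) (k + 1)"
    by (rule card_large_subsets) auto
  moreover have "card {A. A \<subseteq> {2..2 * k + 1} \<and> 2 * k - 1 \<le> card A} = binomial_tail (Suc (2 * k - 1)) (2 * k - 1)"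
    using assms by (intro card_large_subsets) auto
  ultimately have "card (extremal_family (2 * k + 1)) = binomial_tail (2 * k) (k + 1) + (2 * k - 1 + 2)"
    using card_link_deletion[of "extremal_family (2 * k + 1)" 1]
    unfolding link_extremal_family[OF assms] deletion_extremal_family[OF assms] binomial_tail_pred
    by simp
  then show ?thesis using assms by simp
qed

text \<open>Katona's bound for \<open>t = 2\<close> applies to the link, and the deletion has only
  sets missing at most one point of \<open>{2..2 * k + 1}\<close>. Equality in the sum forces
  equality in both bounds, and each equality case is unique.\<close>

lemma irreducible_bound_odd:
  assumes F: "admissible (2 * k + 1) F" "left_compressed (2 * k + 1) F" and k: "1 \<le> k"
    and large: "\<And>Z. Z \<in> F \<Longrightarrow> 1 \<notin> Z \<Longrightarrow> 2 * k - 1 \<le> card Z"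
  shows "card F \<le> card (extremal_family (2 * k + 1))"
    and "card F = card (extremal_family (2 * k + 1)) \<Longrightarrow> F = extremal_family (2 * k + 1)"
proof -
  have n: "Suc (Suc (2 * k - 1)) = 2 * k + 1" using k by simp
  have F1: "F \<subseteq> Pow {1..Suc (Suc (2 * k - 1))}" using F(1) n by (simp add: admissible_def)
  have D: "card (deletion 1 F) \<le> 2 * k - 1 + 2"
      "card (deletion 1 F) = 2 * k - 1 + 2 \<Longrightarrow>
        deletion 1 F = {Z. Z \<subseteq> {2..2 * k + 1} \<and> 2 * k - 1 \<le> card Z}"
    using card_deletion_large[OF F1 large] unfolding n by simp_all
  have ground: "link 1 F \<subseteq> Pow {Suc 1..1 + 2 * k}" "compressed_above 1 (1 + 2 * k) (link 1 F)"
    using link_1_ground[OF F] link_1_compressed[OF F] by (simp_all add: numeral_2_eq_2)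
  have L: "card (link 1 F) \<le> binomial_tail (2 * k) (k + 1)"
    using katona_bound[of "link 1 F" 1 "2 * k" 0 2 "k + 1"] ground link_1_t_intersecting[OF F] by simp
  have card: "card F = card (link 1 F) + card (deletion 1 F)"
    by (rule card_link_deletion) (rule admissible_finite[OF F(1)])
  show "card F \<le> card (extremal_family (2 * k + 1))"
    using D(1) L card card_extremal_family[OF k] k by simp
  assume "card F = card (extremal_family (2 * k + 1))"
  then have eq: "card (link 1 F) = binomial_tail (2 * k) (k + 1)" "card (deletion 1 F) = 2 * k - 1 + 2"
    using D(1) L card card_extremal_family[OF k] k by auto
  have "link 1 F = {A. A \<subseteq> {Suc 1..1 + 2 * k} \<and> k + 1 \<le> card A}"
    using katona_unique[of "link 1 F" 1 "2 * k" 2 "k + 1"] ground link_1_t_intersecting[OF F] eq by simp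
  also have "{Suc 1..1 + 2 * k} = {2..2 * k + 1}" by auto
  also note link_extremal_family[OF k, symmetric]
  finally show "F = extremal_family (2 * k + 1)"
    by (rule family_eqI) (simp only: D(2)[OF eq(2)] deletion_extremal_family[OF k])
qed

text \<open>The link lives on \<open>2 * k + 1\<close> points, the wrong parity for
  \<open>t = 2\<close>; \<open>katona_bound\<close> with \<open>e = 1\<close> costs a factor
  2.\<close>

lemma irreducible_bound_even:
  assumes F: "admissible (2 * k + 2) F" "left_compressed (2 * k + 2) F"
    and large: "\<And>Z. Z \<in> F \<Longrightarrow> 1 \<notin> Z \<Longrightarrow> 2 * k \<le> card Z"
  shows "card F \<le> 2 * binomial_tail (2 * k) (k + 1) + 2 * k + 2"
proof -
  have F1: "F \<subseteq> Pow {1..Suc (Suc (2 * k))}" using F(1) by (simp add: admissible_def)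
  note D = card_deletion_large(1)[OF F1 large]
  have "link 1 F \<subseteq> Pow {Suc 1..1 + 2 * k + 1}" "compressed_above 1 (1 + 2 * k + 1) (link 1 F)"
    using link_1_ground[OF F] link_1_compressed[OF F] by (simp_all add: numeral_2_eq_2)
  then have L: "card (link 1 F) \<le> 2 * binomial_tail (2 * k) (k + 1)"
    using katona_bound[of "link 1 F" 1 "2 * k" 1 2 "k + 1"] link_1_t_intersecting[OF F] by simp
  have "card F = card (link 1 F) + card (deletion 1 F)"
    by (rule card_link_deletion) (rule admissible_finite[OF F(1)])
  then show ?thesis using D L by simp
qed

section \<open>Up-closure of maximum families\<close>

definition up_closed :: "nat \<Rightarrow> nat set set \<Rightarrow> bool" where
  "up_closed n F \<longleftrightarrow> (\<forall>A\<in>F. \<forall>B. A \<subseteq> B \<longrightarrow> B \<subseteq> {1..n} \<longrightarrow> B \<in> F)"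

lemma up_closedD: "\<lbrakk>up_closed n F; A \<in> F; A \<subseteq> B; B \<subseteq> {1..n}\<rbrakk> \<Longrightarrow> B \<in> F"
  by (auto simp: up_closed_def)

text \<open>Adding a superset of a member can only enlarge intersections, so the family stays
  admissible and maximality means that the superset was already present.\<close>

lemma up_closed_if_maximum:
  assumes F: "admissible n F" and max: "\<And>G. admissible n G \<Longrightarrow> card G \<le> card F"
  shows "up_closed n F"
  unfolding up_closed_def
proof (intro ballI allI impI)
  fix A B assume A: "A \<in> F" "A \<subseteq> B" "B \<subseteq> {1..n}"
  have below: "\<exists>C'\<in>F. C' \<subseteq> C" if "C \<in> insert B F" for C
    using that A by auto
  have fin: "finite C" if "C \<in> insert B F" for C
    using that A(3) admissible_finite_member[OF F] finite_subset by auto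
  have "admissible n (insert B F)"
    unfolding admissible_def
  proof (intro conjI)
    show "insert B F \<subseteq> Pow {1..n}" using A(3) F by (auto simp: admissible_def)
    show "three_wise_intersecting (insert B F)"
      unfolding three_wise_intersecting_def
    proof (intro ballI)
      fix C D E assume "C \<in> insert B F" "D \<in> insert B F" "E \<in> insert B F"
      then obtain C' D' E' where *: "C' \<in> F" "D' \<in> F" "E' \<in> F" "C' \<subseteq> C" "D' \<subseteq> D" "E' \<subseteq> E"
        using below by meson
      then have "C' \<inter> D' \<inter> E' \<noteq> {}"
        using F unfolding admissible_def three_wise_intersecting_def by blast
      then show "C \<inter> D \<inter> E \<noteq> {}" using * by blast
    qed
    show "t_intersecting 3 (insert B F)"
      unfolding t_intersecting_def
    proof (intro ballI)
      fix C D assume CD: "C \<in> insert B F" "D \<in> insert B F"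
      then obtain C' D' where *: "C' \<in> F" "D' \<in> F" "C' \<subseteq> C" "D' \<subseteq> D"
        using below by meson
      then have "3 \<le> card (C' \<inter> D')"
        using F unfolding admissible_def t_intersecting_def by blast
      also have "\<dots> \<le> card (C \<inter> D)" using * fin[OF CD(1)] by (intro card_mono) auto
      finally show "3 \<le> card (C \<inter> D)" .
    qed
  qed
  then have "card (insert B F) \<le> card F" by (rule max)
  then show "B \<in> F"
    using admissible_finite[OF F] by (metis card_insert_disjoint not_less_eq_eq order_refl)
qed

section \<open>Uniqueness in the reducible case\<close>

lemma tails_up:
  assumes "up_closed (Suc (Suc q)) F" "X \<subseteq> {1..q}" "T \<in> tails q F X" "T \<subseteq> T'" "T' \<subseteq> {Suc q, Suc (Suc q)}"
  shows "T' \<in> tails q F X"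
proof -
  have "X \<union> T' \<subseteq> {1..Suc (Suc q)}" using assms(2,5) by fastforce
  then have "X \<union> T' \<in> F"
    using up_closedD[OF assms(1), of "X \<union> T" "X \<union> T'"] assms(3,4) by (auto simp: tails_def)
  then show ?thesis using assms(5) by (simp add: tails_def)
qed

lemma tails_last:
  assumes "left_compressed (Suc (Suc q)) F" "X \<subseteq> {1..q}" "{Suc (Suc q)} \<in> tails q F X"
  shows "{Suc q} \<in> tails q F X"
proof -
  have notin: "Suc q \<notin> X" "Suc (Suc q) \<notin> X" using assms(2) by auto
  have "X \<union> {Suc (Suc q)} \<in> F" using assms(3) by (simp add: tails_def)
  then have "insert (Suc q) (X \<union> {Suc (Suc q)} - {Suc (Suc q)}) \<in> F"
    using notin by (intro left_compressedD[OF assms(1)]) auto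
  moreover have "insert (Suc q) (X \<union> {Suc (Suc q)} - {Suc (Suc q)}) = X \<union> {Suc q}"
    using notin by auto
  ultimately show ?thesis by (simp add: tails_def)
qed

text \<open>Without the tail \<open>{q + 1}\<close>, up-closure rules out the empty tail and
  compression rules out \<open>{q + 2}\<close>. Only the full pair is left, so the multiplicity is
  at most one.\<close>

lemma heavy_2_tail:
  assumes "left_compressed (Suc (Suc q)) F" "up_closed (Suc (Suc q)) F" "X \<in> heavy q F 2"
  shows "{Suc q} \<in> tails q F X"
proof (rule ccontr)
  assume no: "{Suc q} \<notin> tails q F X"
  have X: "X \<subseteq> {1..q}" using assms(3) by (simp add: heavy_def)
  have "T = {Suc q, Suc (Suc q)}" if T: "T \<in> tails q F X" for T
  proof -
    have sub: "T \<subseteq> {Suc q, Suc (Suc q)}" using T by (simp add: tails_def)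
    have "\<not> T \<subseteq> {Suc q}" using tails_up[OF assms(2) X T, of "{Suc q}"] no by blast
    moreover have "\<not> T \<subseteq> {Suc (Suc q)}"
      using tails_up[OF assms(2) X T, of "{Suc (Suc q)}"] tails_last[OF assms(1) X] no by blast
    ultimately show ?thesis using sub by blast
  qed
  then have "tails q F X \<subseteq> {{Suc q, Suc (Suc q)}}" by blast
  then have "card (tails q F X) \<le> 1" using card_mono[of "{{Suc q, Suc (Suc q)}}"] by simp
  then show False using assms(3) by (simp add: heavy_def)
qed

lemma heavy_4_iff: "X \<in> heavy q F 4 \<longleftrightarrow> X \<subseteq> {1..q} \<and> tails q F X = Pow {Suc q, Suc (Suc q)}"
proof -
  have "card (Pow {Suc q, Suc (Suc q)}) = 4" by (simp add: card_Pow)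
  then have "4 \<le> card (tails q F X) \<longleftrightarrow> tails q F X = Pow {Suc q, Suc (Suc q)}"
    using card_seteq[OF _ tails_Pow, of q F X] by (metis finite.emptyI finite_Pow_iff finite_insert order_refl)
  then show ?thesis by (simp add: heavy_def)
qed

lemma heavy_compressed:
  assumes F: "left_compressed (Suc (Suc q)) F" and X: "X \<in> heavy q F k"
    and ij: "1 \<le> i" "i < j" "j \<le> q" "j \<in> X" "i \<notin> X"
  shows "insert i (X - {j}) \<in> heavy q F k"
proof -
  have "tails q F X \<subseteq> tails q F (insert i (X - {j}))"
  proof
    fix T assume T: "T \<in> tails q F X"
    then have notin: "i \<notin> T" "j \<notin> T" using ij by (auto simp: tails_def)
    have "insert i (X \<union> T - {j}) \<in> F"
      using T ij notin by (intro left_compressedD[OF F]) (auto simp: tails_def)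
    moreover have "insert i (X \<union> T - {j}) = insert i (X - {j}) \<union> T"
      using notin by blast
    ultimately show "T \<in> tails q F (insert i (X - {j}))"
      using T by (simp add: tails_def)
  qed
  then have "card (tails q F X) \<le> card (tails q F (insert i (X - {j})))"
    by (rule card_mono[OF finite_tails])
  then show ?thesis using X ij by (auto simp: heavy_def)
qed

text \<open>Exchanges within \<open>[q]\<close> preserve multiplicities from below. The critical
  exchange replaces \<open>q + 1\<close> by \<open>i\<close>, where multiplicity 2 has to rise to
  3.\<close>

lemma left_compressed_fold_family:
  assumes F: "left_compressed (Suc (Suc q)) F" and up: "up_closed (Suc (Suc q)) F"
  shows "left_compressed (Suc q) (fold_family q F 3 2)"
  unfolding left_compressed_def
proof (intro allI ballI impI)
  fix i j A assume ij: "1 \<le> i \<and> i < j \<and> j \<le> Suc q" and A: "A \<in> fold_family q F 3 2" "j \<in> A \<and> i \<notin> A"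
  consider (without) "A \<in> heavy q F 3" | (with_last) X where "X \<in> heavy q F 2" "A = insert (Suc q) X"
    using A(1) by (auto simp: fold_family_def)
  then have "insert i (A - {j}) \<in> fold_family q F 3 2"
  proof cases
    case without
    then have "j \<noteq> Suc q" using A(2) by (auto simp: heavy_def)
    then have "insert i (A - {j}) \<in> heavy q F 3"
      using ij A(2) by (intro heavy_compressed[OF F without]) auto
    then show ?thesis by (simp add: fold_family_def)
  next
    case with_last
    then have X: "X \<subseteq> {1..q}" by (simp add: heavy_def)
    then have notin: "Suc q \<notin> X" by auto
    show ?thesis
    proof (cases "j = Suc q")
      \<comment> \<open>\<open>X\<close> has the tail \<open>{q + 1}\<close>, and compressing this
        member of \<open>F\<close> puts \<open>insert i X\<close> itself into \<open>F\<close>. By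
        up-closure all four tails then occur.\<close>
      case True
      have "i \<notin> X" "i \<le> q" using A(2) with_last(2) ij True by auto
      have "X \<union> {Suc q} \<in> F"
        using heavy_2_tail[OF F up with_last(1)] by (simp add: tails_def)
      then have "insert i (X \<union> {Suc q} - {Suc q}) \<in> F"
        using ij True \<open>i \<notin> X\<close> by (intro left_compressedD[OF F]) auto
      moreover have "insert i (X \<union> {Suc q} - {Suc q}) = insert i X \<union> {}"
        using notin ij True by auto
      ultimately have "{} \<in> tails q F (insert i X)" by (simp add: tails_def)
      moreover have iX: "insert i X \<subseteq> {1..q}" using X ij \<open>i \<le> q\<close> by simp
      ultimately have "tails q F (insert i X) = Pow {Suc q, Suc (Suc q)}"
        using tails_up[OF up iX, of "{}"] tails_Pow[of q F "insert i X"] by blast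
      then have "insert i X \<in> heavy q F 4" using iX by (simp add: heavy_4_iff)
      then have "insert i X \<in> heavy q F 3" using heavy_antimono[of 3 4 q F] by auto
      moreover have "insert i (A - {j}) = insert i X" using with_last(2) True notin by auto
      ultimately show ?thesis by (simp add: fold_family_def)
    next
      case False
      have "insert i (X - {j}) \<in> heavy q F 2"
        using ij A(2) with_last(2) False by (intro heavy_compressed[OF F with_last(1)]) auto
      moreover have "insert i (A - {j}) = insert (Suc q) (insert i (X - {j}))"
        using with_last(2) False by auto
      ultimately show ?thesis by (simp add: fold_family_def)
    qed
  qed
  then show "A - {j} \<union> {i} \<in> fold_family q F 3 2" by simp
qed

text \<open>\<open>E\<close> on \<open>[q + 1]\<close> blocks every trace on \<open>[q]\<close> outside it by two of its members, chosen so that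
  the multiplicities 3 and 2 of their traces add up to 5.\<close>

definition blocking :: "nat \<Rightarrow> nat set set \<Rightarrow> bool" where
  "blocking q E \<longleftrightarrow> (\<forall>X. X \<subseteq> {1..q} \<longrightarrow> insert (Suc q) X \<notin> E \<longrightarrow>
     (\<exists>Y Z. Y \<subseteq> {1..q} \<and> Z \<subseteq> {1..q} \<and> Y \<in> E \<and> insert (Suc q) Z \<in> E \<and> Y \<inter> Z \<inter> X = {}))"

text \<open>Blocking excludes multiplicity 1, and equality of the sizes of the two folds then
  excludes multiplicity 3. The remaining multiplicities 2 and 4 mean that membership depends only on
  the trace on \<open>[q + 1]\<close>.\<close>

lemma family_eq_times_cube:
  assumes F: "admissible (Suc (Suc q)) F" "left_compressed (Suc (Suc q)) F" "up_closed (Suc (Suc q)) F"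
    and E: "fold_family q F 3 2 = E" "blocking q E"
    and card: "card (fold_family q F 4 1) = card E"
  shows "F = times_cube (Suc q) E 1"
proof -
  have U: "X \<in> heavy q F 3 \<longleftrightarrow> X \<in> E" "X \<in> heavy q F 2 \<longleftrightarrow> insert (Suc q) X \<in> E" if "X \<subseteq> {1..q}" for X
  proof -
    have notin: "Suc q \<notin> Y" if "Y \<subseteq> {1..q}" for Y using that by auto
    have "Suc q \<notin> Y" if "Y \<in> heavy q F k" for Y k using that notin by (simp add: heavy_def)
    moreover note notin[OF \<open>X \<subseteq> {1..q}\<close>]
    ultimately show "X \<in> heavy q F 3 \<longleftrightarrow> X \<in> E" "X \<in> heavy q F 2 \<longleftrightarrow> insert (Suc q) X \<in> E"
      unfolding E(1)[symmetric] fold_family_def by (blast, auto dest: insert_ident[THEN iffD1, rotated 2])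
  qed
  have sub1: "heavy q F 1 \<subseteq> heavy q F 2"
  proof
    fix X assume X: "X \<in> heavy q F 1"
    then have Xq: "X \<subseteq> {1..q}" by (simp add: heavy_def)
    show "X \<in> heavy q F 2"
    proof (rule ccontr)
      assume "X \<notin> heavy q F 2"
      then have "insert (Suc q) X \<notin> E" using U(2)[OF Xq] by simp
      from E(2)[unfolded blocking_def, rule_format, OF Xq this] obtain Y Z where YZ: "Y \<subseteq> {1..q}" "Z \<subseteq> {1..q}" "Y \<in> E" "insert (Suc q) Z \<in> E" "Y \<inter> Z \<inter> X = {}"
        by (elim exE conjE)
      then have "Y \<in> heavy q F 3" "Z \<in> heavy q F 2" using U by simp_all
      then have "Y \<inter> Z \<inter> X \<noteq> {}"
        using heavy_three_wise[of F Y q 3 Z 2 X] X F(1) by (simp add: admissible_def)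
      then show False using YZ(5) by simp
    qed
  qed
  have sub4: "heavy q F 4 \<subseteq> heavy q F 3" by (rule heavy_antimono) simp
  \<comment> \<open>Both folds have the size of \<open>E\<close>; as heavy sets for 1 lie among
    those for 2, and those for 4 among those for 3, both inclusions must be equalities.\<close>
  have "card (heavy q F 4) + card (heavy q F 1) = card (heavy q F 3) + card (heavy q F 2)"
    using card unfolding E(1)[symmetric] card_fold_family .
  moreover have "card (heavy q F 1) \<le> card (heavy q F 2)" "card (heavy q F 4) \<le> card (heavy q F 3)"
    using card_mono[OF finite_heavy] sub1 sub4 by auto
  ultimately have "card (heavy q F 1) = card (heavy q F 2)" "card (heavy q F 4) = card (heavy q F 3)"
    by simp_all
  then have eq: "heavy q F 1 = heavy q F 2" "heavy q F 4 = heavy q F 3"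
    using card_subset_eq[OF finite_heavy sub1] card_subset_eq[OF finite_heavy sub4] by simp_all
  show ?thesis
  proof (rule set_eqI)
    fix A
    show "A \<in> F \<longleftrightarrow> A \<in> times_cube (Suc q) E 1"
    proof (cases "A \<subseteq> {1..Suc (Suc q)}")
      case False
      then show ?thesis using F(1) by (auto simp: admissible_def times_cube_def)
    next
      case True
      define X T where "X = A \<inter> {1..q}" and "T = A \<inter> {Suc q, Suc (Suc q)}"
      have X: "X \<subseteq> {1..q}" by (simp add: X_def)
      have T: "T \<subseteq> {Suc q, Suc (Suc q)}" by (simp add: T_def)
      have A: "A = X \<union> T" using True unfolding X_def T_def by (force simp: le_Suc_eq)
      have AF: "A \<in> F \<longleftrightarrow> T \<in> tails q F X" using A T by (simp add: tails_def)
      have AE: "A \<in> times_cube (Suc q) E 1 \<longleftrightarrow> A \<inter> {1..Suc q} \<in> E"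
        using True by (simp add: times_cube_def)
      have nonempty: "X \<in> heavy q F 1" if "A \<in> F"
      proof -
        have "0 < card (tails q F X)"
          using that AF finite_tails by (auto simp: card_gt_0_iff)
        then show ?thesis using X by (simp add: heavy_def)
      qed
      show ?thesis
      proof (cases "Suc q \<in> A")
        case in_A: True
        have "A \<inter> {1..Suc q} = insert (Suc q) X"
          using in_A unfolding X_def by (auto simp: le_Suc_eq)
        then have "A \<in> times_cube (Suc q) E 1 \<longleftrightarrow> X \<in> heavy q F 2"
          using AE U(2)[OF X] by simp
        moreover have "A \<in> F" if "X \<in> heavy q F 2"
        proof -
          have "{Suc q} \<subseteq> T" using in_A by (simp add: T_def)
          then show ?thesis
            using tails_up[OF F(3) X heavy_2_tail[OF F(2,3) that]] T AF by simp
        qed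
        ultimately show ?thesis using nonempty eq by blast
      next
        case not_in_A: False
        have "A \<inter> {1..Suc q} = X"
          using not_in_A unfolding X_def by (auto simp: le_Suc_eq)
        then have E3: "A \<in> times_cube (Suc q) E 1 \<longleftrightarrow> X \<in> heavy q F 3"
          using AE U(1)[OF X] by simp
        have "A \<in> F" if "X \<in> heavy q F 3"
        proof -
          have "X \<in> heavy q F 4" using that unfolding eq(2) .
          then show ?thesis using AF T by (simp add: heavy_4_iff)
        qed
        \<comment> \<open>A tail inside \<open>{q + 2}\<close> yields \<open>{q + 2}\<close> and the
          full pair by up-closure and \<open>{q + 1}\<close> by compression, three tails in
          all.\<close>
        moreover have "X \<in> heavy q F 3" if "A \<in> F"
        proof -
          have "T \<subseteq> {Suc (Suc q)}" using not_in_A T by (auto simp: T_def)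
          then have t2: "{Suc (Suc q)} \<in> tails q F X"
            using tails_up[OF F(3) X] AF that by blast
          then have "{{Suc q}, {Suc (Suc q)}, {Suc q, Suc (Suc q)}} \<subseteq> tails q F X"
            using tails_last[OF F(2) X t2] tails_up[OF F(3) X t2, of "{Suc q, Suc (Suc q)}"] by blast
          then have "card {{Suc q}, {Suc (Suc q)}, {Suc q, Suc (Suc q)}} \<le> card (tails q F X)"
            by (rule card_mono[OF finite_tails])
          moreover have "card {{Suc q}, {Suc (Suc q)}, {Suc q, Suc (Suc q)}} = 3"
            by (simp add: doubleton_eq_iff)
          ultimately show ?thesis using X by (simp add: heavy_def)
        qed
        ultimately show ?thesis using E3 by blast
      qed
    qed
  qed
qed

section \<open>Compression, admissibility and blocking for the extremal family\<close>

lemma card_Int_ge: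
  assumes "finite S" "A \<subseteq> S" "B \<subseteq> S"
  shows "card A + card B \<le> card S + card (A \<inter> B)"
proof -
  have "card A + card B = card (A \<union> B) + card (A \<inter> B)"
    using assms by (intro card_Un_Int) (auto intro: finite_subset)
  moreover have "card (A \<union> B) \<le> card S" using assms by (intro card_mono) auto
  ultimately show ?thesis by simp
qed

lemma extremal_family_iff:
  "A \<in> extremal_family (2 * k + 1) \<longleftrightarrow> A \<subseteq> {1..2 * k + 1} \<and>
     (if 1 \<in> A then k + 2 \<le> card A else 2 * k - 1 \<le> card A)"
  by (auto simp: extremal_family_def)

text \<open>An exchange keeps the size, and bringing in the point 1 only lowers the requirement,
  because \<open>k + 2 \<le> 2 * k - 1\<close>.\<close>

lemma left_compressed_extremal_family:
  assumes "3 \<le> k"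
  shows "left_compressed (2 * k + 1) (extremal_family (2 * k + 1))"
  unfolding left_compressed_def
proof (intro ballI allI impI)
  fix i j A assume ij: "1 \<le> i \<and> i < j \<and> j \<le> 2 * k + 1"
    and A: "A \<in> extremal_family (2 * k + 1)" "j \<in> A \<and> i \<notin> A"
  have A': "A \<subseteq> {1..2 * k + 1}" "if 1 \<in> A then k + 2 \<le> card A else 2 * k - 1 \<le> card A"
    using A(1) unfolding extremal_family_iff by blast+
  have fin: "finite A" using A'(1) finite_subset by blast
  have "card (A - {j} \<union> {i}) = card A"
    using A(2) fin card_Suc_Diff1[OF fin, of j] by simp
  moreover have "A - {j} \<union> {i} \<subseteq> {1..2 * k + 1}" using A'(1) ij by auto
  moreover have "1 \<in> A - {j} \<union> {i} \<longleftrightarrow> 1 \<in> A \<or> i = 1" using ij by auto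
  ultimately show "A - {j} \<union> {i} \<in> extremal_family (2 * k + 1)"
    unfolding extremal_family_iff using A'(2) assms by (auto split: if_splits)
qed

text \<open>Drop the point 1 and count on the other \<open>2 * k\<close> points. Members keep at
  least \<open>k + 1\<close> points there, and \<open>2 * k - 1\<close> if they avoid 1. Two of them
  share at least 2 points, and at least \<open>k \<ge> 3\<close> if one avoids 1.\<close>

lemma admissible_extremal_family:
  assumes "3 \<le> k"
  shows "admissible (2 * k + 1) (extremal_family (2 * k + 1))"
proof -
  let ?F = "extremal_family (2 * k + 1)"
  define S where "S = {2..2 * k + 1}"
  have S: "finite S" "card S = 2 * k" by (simp_all add: S_def)
  have ground: "{1..2 * k + 1} = insert 1 S" "1 \<notin> S" by (auto simp: S_def)
  have core: "k + 1 \<le> card (A - {1})" "1 \<notin> A \<Longrightarrow> 2 * k - 1 \<le> card (A - {1})" "A - {1} \<subseteq> S" "finite A"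
    if "A \<in> ?F" for A
  proof -
    have A: "A \<subseteq> insert 1 S" "if 1 \<in> A then k + 2 \<le> card A else 2 * k - 1 \<le> card A"
      using that ground unfolding extremal_family_iff by auto
    show fin: "finite A" using A(1) S finite_subset by blast
    show "A - {1} \<subseteq> S" using A(1) by blast
    show "k + 1 \<le> card (A - {1})"
      using A(2) fin assms by (auto split: if_splits)
    show "2 * k - 1 \<le> card (A - {1})" if "1 \<notin> A"
      using A(2) that by simp
  qed
  have pair: "2 \<le> card ((A - {1}) \<inter> (B - {1})) \<and> (1 \<notin> A \<longrightarrow> 3 \<le> card ((A - {1}) \<inter> (B - {1})))"
    if "A \<in> ?F" "B \<in> ?F" for A B
    using card_Int_ge[OF S(1) core(3)[OF that(1)] core(3)[OF that(2)]] S(2)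
      core(1)[OF that(1)] core(1)[OF that(2)] core(2)[OF that(1)] assms by linarith
  have three: "3 \<le> card (A \<inter> B)" if AB: "A \<in> ?F" "B \<in> ?F" for A B
  proof (cases "1 \<in> A \<and> 1 \<in> B")
    case True
    then have "A \<inter> B = insert 1 ((A - {1}) \<inter> (B - {1}))" by blast
    then have "card (A \<inter> B) = Suc (card ((A - {1}) \<inter> (B - {1})))"
      using core(4)[OF AB(1)] by simp
    then show ?thesis using pair[OF AB] by simp
  next
    case False
    then have "3 \<le> card ((A - {1}) \<inter> (B - {1}))"
      using pair[OF AB] pair[OF AB(2,1)] by (auto simp: Int_commute)
    also have "\<dots> \<le> card (A \<inter> B)"
      using core(4)[OF AB(1)] by (intro card_mono) auto
    finally show ?thesis .
  qed
  have "A \<inter> B \<inter> C \<noteq> {}" if "A \<in> ?F" "B \<in> ?F" "C \<in> ?F" for A B C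
  proof -
    have *: "A \<inter> B \<inter> C \<noteq> {}" if ABC: "A \<in> ?F" "B \<in> ?F" "C \<in> ?F" "1 \<notin> A" for A B C
    proof -
      have "(B - {1}) \<inter> (C - {1}) \<subseteq> S" using core(3)[OF ABC(2)] by blast
      \<comment> \<open>\<open>A\<close> misses at most one of the \<open>2 * k\<close> points of
        \<open>S\<close>, while \<open>B\<close> and \<open>C\<close> share at least two of
        them.\<close>
      then have "2 * k - 1 + 2 \<le> 2 * k + card ((A - {1}) \<inter> ((B - {1}) \<inter> (C - {1})))"
        using card_Int_ge[OF S(1) core(3)[OF ABC(1)], of "(B - {1}) \<inter> (C - {1})"] S(2)
          core(2)[OF ABC(1,4)] pair[OF ABC(2,3)] by linarith
      then have "card ((A - {1}) \<inter> ((B - {1}) \<inter> (C - {1}))) \<noteq> 0" using assms by linarith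
      then have "(A - {1}) \<inter> ((B - {1}) \<inter> (C - {1})) \<noteq> {}" by (metis card.empty)
      then show ?thesis by blast
    qed
    show ?thesis
      using *[OF that] *[OF that(2,1,3)] *[OF that(3,1,2)] by blast
  qed
  then have "three_wise_intersecting ?F" by (simp add: three_wise_intersecting_def)
  moreover have "t_intersecting 3 ?F" using three by (simp add: t_intersecting_def)
  moreover have "?F \<subseteq> Pow {1..2 * k + 1}" by (auto simp: extremal_family_def)
  ultimately show ?thesis by (simp add: admissible_def)
qed

lemma blocking_extremal_family:
  assumes "3 \<le> k"
  shows "blocking (2 * k) (extremal_family (Suc (2 * k)))"
  unfolding blocking_def
proof (intro allI impI)
  let ?F = "extremal_family (Suc (2 * k))"
  define S where "S = {2..2 * k}"
  have S: "finite S" "card S = 2 * k - 1" "1 \<notin> S" by (simp_all add: S_def)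
  have ground: "{1..2 * k} = insert 1 S" using assms by (auto simp: S_def)
  have big: "Suc (2 * k) \<notin> Y" "finite Y" if "Y \<subseteq> insert 1 S" for Y
    using that S assms finite_subset by (auto simp: S_def)
  have mem: "Y \<in> ?F \<longleftrightarrow> (if 1 \<in> Y then k + 2 \<le> card Y else 2 * k - 1 \<le> card Y)"
      "insert (Suc (2 * k)) Y \<in> ?F \<longleftrightarrow> (if 1 \<in> Y then k + 1 \<le> card Y else 2 * k - 2 \<le> card Y)"
    if Y: "Y \<subseteq> insert 1 S" for Y
  proof -
    have "insert 1 S \<subseteq> {1..2 * k + 1}" using ground by auto
    then have "Y \<subseteq> {1..2 * k + 1}" "insert (Suc (2 * k)) Y \<subseteq> {1..2 * k + 1}"
      using Y by auto
    moreover have "card (insert (Suc (2 * k)) Y) = Suc (card Y)" using big[OF Y] by simp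
    ultimately show "Y \<in> ?F \<longleftrightarrow> (if 1 \<in> Y then k + 2 \<le> card Y else 2 * k - 1 \<le> card Y)"
      "insert (Suc (2 * k)) Y \<in> ?F \<longleftrightarrow> (if 1 \<in> Y then k + 1 \<le> card Y else 2 * k - 2 \<le> card Y)"
      using assms extremal_family_iff[of Y k] extremal_family_iff[of "insert (Suc (2 * k)) Y" k]
      by auto
  qed
  fix X assume "X \<subseteq> {1..2 * k}" and out: "insert (Suc (2 * k)) X \<notin> ?F"
  then have X: "X \<subseteq> insert 1 S" using ground by simp
  have "\<exists>Y Z. Y \<subseteq> insert 1 S \<and> Z \<subseteq> insert 1 S \<and> Y \<in> ?F \<and> insert (Suc (2 * k)) Z \<in> ?F \<and> Y \<inter> Z \<inter> X = {}"
  proof (cases "1 \<in> X")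
    case True
    \<comment> \<open>Block with \<open>Y = S\<close>, which avoids only 1, and \<open>Z\<close>
      consisting of 1 and the complement of \<open>X\<close> in \<open>S\<close>;
      \<open>card X \<le> k\<close> makes \<open>Z\<close> large enough.\<close>
    then have "card X \<le> k" using out mem(2)[OF X] by auto
    then have "card (X - {1}) \<le> k - 1" using True big(2)[OF X] by simp
    moreover have "card S - card (X - {1}) \<le> card (S - (X - {1}))"
      by (rule diff_card_le_card_Diff) (use big(2)[OF X] in simp)
    ultimately have "k \<le> card (S - (X - {1}))" using S(2) assms by linarith
    moreover have "card (insert 1 (S - (X - {1}))) = Suc (card (S - (X - {1})))"
      using S by (intro card_insert_disjoint) auto
    ultimately have "insert (Suc (2 * k)) (insert 1 (S - (X - {1}))) \<in> ?F"
      by (subst mem(2)) auto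
    moreover have "S \<in> ?F" using S by (subst mem(1)) auto
    moreover have "S \<inter> insert 1 (S - (X - {1})) \<inter> X = {}" using S(3) by blast
    moreover have "S \<subseteq> insert 1 S" "insert 1 (S - (X - {1})) \<subseteq> insert 1 S" by blast+
    ultimately show ?thesis
      by - (rule exI[of _ S], rule exI[of _ "insert 1 (S - (X - {1}))"], intro conjI)
  next
    case False
    \<comment> \<open>\<open>X\<close> misses a pair \<open>C\<close> of points of \<open>S\<close>.
      Put 1 and \<open>C\<close> into both \<open>Y\<close> and \<open>Z\<close> and divide the
      other \<open>2 * k - 3\<close> points of \<open>S\<close> into parts of sizes
      \<open>k - 1\<close> and \<open>k - 2\<close>; then \<open>Y\<close> and \<open>Z\<close> meet
      only in 1 and \<open>C\<close>.\<close>
    then have XS: "X \<subseteq> S" using X by blast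
    have "card X < 2 * k - 2" using out mem(2)[OF X] False by auto
    moreover have "card (S - X) = card S - card X"
      using XS S finite_subset by (intro card_Diff_subset) auto
    ultimately have "2 \<le> card (S - X)" using S(2) by linarith
    then obtain C where C: "C \<subseteq> S - X" "card C = 2" by (meson obtain_subset_with_card_n)
    then have finC: "finite C" and CS: "C \<subseteq> S" using S finite_subset by auto
    have "card (S - C) = 2 * k - 3" using C CS finC S(2) by (simp add: card_Diff_subset)
    then have "k - 1 \<le> card (S - C)" using assms by linarith
    then obtain D where D: "D \<subseteq> S - C" "card D = k - 1"
      by (rule obtain_subset_with_card_n)
    then have finD: "finite D" using S finite_subset by blast
    define D' where "D' = S - C - D"
    have D': "card D' = k - 2" "finite D'"
      using D finD \<open>card (S - C) = 2 * k - 3\<close> S(1) assms by (simp_all add: D'_def card_Diff_subset)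
    have card_C: "card (insert 1 (C \<union> G)) = 3 + card G" if "G \<subseteq> S - C" "finite G" for G
    proof -
      have "card (C \<union> G) = card C + card G"
        using that finC by (intro card_Un_disjoint) auto
      moreover have "1 \<notin> C \<union> G" using that(1) CS S(3) by blast
      ultimately show ?thesis using that(2) finC C(2) by simp
    qed
    have "card (insert 1 (C \<union> D)) = k + 2"
      using card_C[OF D(1) finD] D(2) assms by simp
    then have "insert 1 (C \<union> D) \<in> ?F" using CS D by (subst mem(1)) auto
    moreover have "card (insert 1 (C \<union> D')) = k + 1"
      using card_C[of D'] D' assms by (simp add: D'_def Diff_subset)
    then have "insert (Suc (2 * k)) (insert 1 (C \<union> D')) \<in> ?F"
      using CS by (subst mem(2)) (auto simp: D'_def)
    moreover have "insert 1 (C \<union> D) \<inter> insert 1 (C \<union> D') \<inter> X = {}"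
      using C D False by (auto simp: D'_def)
    moreover have "insert 1 (C \<union> D) \<subseteq> insert 1 S" "insert 1 (C \<union> D') \<subseteq> insert 1 S"
      using CS D by (auto simp: D'_def)
    ultimately show ?thesis
      by - (rule exI[of _ "insert 1 (C \<union> D)"], rule exI[of _ "insert 1 (C \<union> D')"], intro conjI)
  qed
  then show "\<exists>Y Z. Y \<subseteq> {1..2 * k} \<and> Z \<subseteq> {1..2 * k} \<and> Y \<in> ?F \<and> insert (Suc (2 * k)) Z \<in> ?F \<and> Y \<inter> Z \<inter> X = {}"
    unfolding ground .
qed

section \<open>Optimal families\<close>

lemma times_cube_0: "F \<subseteq> Pow {1..m} \<Longrightarrow> times_cube m F 0 = F"
  by (auto simp: times_cube_def Int_absorb2)

lemma times_cube_Suc: "times_cube (m + k) (times_cube m F k) 1 = times_cube m F (Suc k)"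
proof -
  have "A \<inter> {1..m + k} \<inter> {1..m} = A \<inter> {1..m}" for A by auto
  then show ?thesis by (simp add: times_cube_def)
qed

lemma card_times_cube_1:
  assumes "F \<subseteq> Pow {1..m}"
  shows "card (times_cube m F 1) = 2 * card F"
proof -
  have notin: "Suc m \<notin> A" if "A \<in> F" for A
  proof -
    have "A \<subseteq> {1..m}" using that assms by blast
    then show ?thesis by auto
  qed
  have fin: "finite F" using assms finite_subset by blast
  have "times_cube m F 1 = F \<union> insert (Suc m) ` F"
  proof (intro subset_antisym subsetI)
    fix A assume A: "A \<in> times_cube m F 1"
    then have A': "A \<subseteq> {1..Suc m}" "A \<inter> {1..m} \<in> F" by (auto simp: times_cube_def)
    show "A \<in> F \<union> insert (Suc m) ` F"
    proof (cases "Suc m \<in> A")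
      case True
      then have "A = insert (Suc m) (A \<inter> {1..m})" using A'(1) by (force simp: le_Suc_eq)
      then show ?thesis using A'(2) by blast
    next
      case False
      then have "A = A \<inter> {1..m}" using A'(1) by (force simp: le_Suc_eq)
      then show ?thesis using A'(2) by simp
    qed
  next
    fix A assume "A \<in> F \<union> insert (Suc m) ` F"
    then obtain B where B: "B \<in> F" "A = B \<or> A = insert (Suc m) B" by blast
    then have "B \<subseteq> {1..m}" using assms by blast
    then have "A \<inter> {1..m} = B" "A \<subseteq> {1..Suc m}" using B(2) by auto
    then show "A \<in> times_cube m F 1" using B(1) by (simp add: times_cube_def)
  qed
  moreover have "card (insert (Suc m) ` F) = card F"
    using notin by (intro card_image inj_onI) (metis insert_ident)
  moreover have "F \<inter> insert (Suc m) ` F = {}" using notin by blast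
  ultimately show ?thesis using fin by (simp add: card_Un_disjoint)
qed

lemma card_times_cube:
  assumes "F \<subseteq> Pow {1..m}"
  shows "card (times_cube m F k) = 2 ^ k * card F"
proof (induction k)
  case 0
  then show ?case using times_cube_0[OF assms] by simp
next
  case (Suc k)
  have "times_cube m F k \<subseteq> Pow {1..m + k}" by (auto simp: times_cube_def)
  then show ?case
    using Suc card_times_cube_1[of "times_cube m F k" "m + k"] by (simp only: times_cube_Suc) simp
qed

lemma admissible_times_cube:
  assumes "admissible m F"
  shows "admissible (m + k) (times_cube m F k)"
  unfolding admissible_def
proof (intro conjI)
  show "times_cube m F k \<subseteq> Pow {1..m + k}" by (auto simp: times_cube_def)
  show "three_wise_intersecting (times_cube m F k)"
    unfolding three_wise_intersecting_def
  proof (intro ballI)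
    fix A B C assume "A \<in> times_cube m F k" "B \<in> times_cube m F k" "C \<in> times_cube m F k"
    then have "A \<inter> {1..m} \<in> F" "B \<inter> {1..m} \<in> F" "C \<inter> {1..m} \<in> F" by (simp_all add: times_cube_def)
    then have "(A \<inter> {1..m}) \<inter> (B \<inter> {1..m}) \<inter> (C \<inter> {1..m}) \<noteq> {}"
      using assms unfolding admissible_def three_wise_intersecting_def by blast
    then show "A \<inter> B \<inter> C \<noteq> {}" by blast
  qed
  show "t_intersecting 3 (times_cube m F k)"
    unfolding t_intersecting_def
  proof (intro ballI)
    fix A B assume AB: "A \<in> times_cube m F k" "B \<in> times_cube m F k"
    then have "A \<inter> {1..m} \<in> F" "B \<inter> {1..m} \<in> F" by (simp_all add: times_cube_def)
    then have "3 \<le> card ((A \<inter> {1..m}) \<inter> (B \<inter> {1..m}))"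
      using assms unfolding admissible_def t_intersecting_def by blast
    also have "A \<subseteq> {1..m + k}" using AB(1) by (simp add: times_cube_def)
    then have "card ((A \<inter> {1..m}) \<inter> (B \<inter> {1..m})) \<le> card (A \<inter> B)"
      by (intro card_mono) (auto intro: finite_subset)
    finally show "3 \<le> card (A \<inter> B)" .
  qed
qed

lemma left_compressed_times_cube:
  assumes "left_compressed m F" "up_closed m F"
  shows "left_compressed (m + k) (times_cube m F k)"
  unfolding left_compressed_def
proof (intro allI ballI impI)
  fix i j A assume ij: "1 \<le> i \<and> i < j \<and> j \<le> m + k" and A: "A \<in> times_cube m F k" "j \<in> A \<and> i \<notin> A"
  then have A': "A \<subseteq> {1..m + k}" "A \<inter> {1..m} \<in> F" by (simp_all add: times_cube_def)
  have "(A - {j} \<union> {i}) \<inter> {1..m} \<in> F"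
  proof (cases "j \<le> m")
    case True
    then have "insert i (A \<inter> {1..m} - {j}) \<in> F"
      using ij A(2) by (intro left_compressedD[OF assms(1) _ _ _ A'(2)]) auto
    also have "insert i (A \<inter> {1..m} - {j}) = (A - {j} \<union> {i}) \<inter> {1..m}"
      using ij True by auto
    finally show ?thesis .
  next
    \<comment> \<open>For \<open>j > m\<close> the trace on \<open>[m]\<close> loses nothing and may
      gain \<open>i\<close>, so up-closure takes the place of compression.\<close>
    case False
    then have "A \<inter> {1..m} \<subseteq> (A - {j} \<union> {i}) \<inter> {1..m}" by auto
    then show ?thesis by (rule up_closedD[OF assms(2) A'(2)]) simp
  qed
  moreover have "A - {j} \<union> {i} \<subseteq> {1..m + k}" using A'(1) ij by auto
  ultimately show "A - {j} \<union> {i} \<in> times_cube m F k" by (simp add: times_cube_def)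
qed

text \<open>The property carried through the induction on \<open>n\<close>. Uniqueness is restricted
  to left-compressed families, since permuting the ground set can give other families of the same
  size.\<close>

definition optimal :: "nat \<Rightarrow> nat set set \<Rightarrow> bool" where
  "optimal n E \<longleftrightarrow> admissible n E \<and> left_compressed n E \<and>
     (\<forall>F. admissible n F \<longrightarrow> card F \<le> card E) \<and>
     (\<forall>F. admissible n F \<longrightarrow> left_compressed n F \<longrightarrow> card F = card E \<longrightarrow> F = E)"

text \<open>Compression preserves sizes, so the bound is needed only for left-compressed families.
  For uniqueness \<open>F\<close> may then be taken to be a maximum family, which makes it
  up-closed.\<close>

lemma optimalI:
  assumes "admissible n E" "left_compressed n E"
    and "\<And>F. admissible n F \<Longrightarrow> left_compressed n F \<Longrightarrow> card F \<le> card E"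
    and "\<And>F. \<lbrakk>admissible n F; left_compressed n F; card F = card E;
      \<And>G. admissible n G \<Longrightarrow> card G \<le> card F\<rbrakk> \<Longrightarrow> F = E"
  shows "optimal n E"
proof -
  have le: "card F \<le> card E" if F: "admissible n F" for F
  proof -
    obtain F' where "admissible n F'" "left_compressed n F'" "card F' = card F"
      using ex_left_compressed[OF F] by (elim exE conjE)
    then show ?thesis using assms(3)[of F'] by simp
  qed
  have "F = E" if "admissible n F" "left_compressed n F" "card F = card E" for F
    by (rule assms(4)[OF that]) (use le that(3) in simp)
  then show ?thesis using assms(1,2) le unfolding optimal_def by blast
qed

lemma optimalD:
  assumes "optimal n E"
  shows "admissible n E" "left_compressed n E" "admissible n F \<Longrightarrow> card F \<le> card E"
    "\<lbrakk>admissible n F; left_compressed n F; card F = card E\<rbrakk> \<Longrightarrow> F = E"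
    "up_closed n E"
proof -
  show E: "admissible n E" "left_compressed n E" "admissible n F \<Longrightarrow> card F \<le> card E"
    "\<lbrakk>admissible n F; left_compressed n F; card F = card E\<rbrakk> \<Longrightarrow> F = E" for F
    using assms by (simp_all add: optimal_def)
  show "up_closed n E" using up_closed_if_maximum[OF E(1)] E(3) by blast
qed

text \<open>The two folds are admissible on \<open>[q + 1]\<close>, so each has at most
  \<open>card E\<close> members, and their sizes add up to \<open>card F\<close>.\<close>

lemma card_reducible_le:
  assumes E: "optimal (Suc q) E" and F: "admissible (Suc (Suc q)) F"
    and red: "\<And>A B. A \<in> F \<Longrightarrow> B \<in> F \<Longrightarrow> 2 \<le> card (A \<inter> B \<inter> {1..q})"
  shows "card F \<le> 2 * card E"
    and "card F = 2 * card E \<Longrightarrow>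
      card (fold_family q F 4 1) = card E \<and> card (fold_family q F 3 2) = card E"
proof -
  have le: "card (fold_family q F 4 1) \<le> card E" "card (fold_family q F 3 2) \<le> card E"
    by (rule optimalD(3)[OF E], rule admissible_fold_family[OF F red]; simp)+
  have card: "card F = card (fold_family q F 4 1) + card (fold_family q F 3 2)"
    using F by (intro card_family_eq_fold_families) (simp add: admissible_def)
  show "card F \<le> 2 * card E" using le card by simp
  show "card (fold_family q F 4 1) = card E \<and> card (fold_family q F 3 2) = card E"
    if "card F = 2 * card E"
    using le card that by linarith
qed

text \<open>The step in which the maximum weight does not change. By \<open>irr\<close>, families of
  size at least \<open>2 * card E\<close> are reducible; in case of equality one fold is
  \<open>E\<close> by uniqueness on \<open>[q + 1]\<close>, and blocking determines the
  family.\<close>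

lemma optimal_times_cube:
  assumes E: "optimal (Suc q) E" "blocking q E"
    and irr: "\<And>F. \<lbrakk>admissible (Suc (Suc q)) F; left_compressed (Suc (Suc q)) F;
      \<And>Z. Z \<in> F \<Longrightarrow> 1 \<notin> Z \<Longrightarrow> q \<le> card Z\<rbrakk> \<Longrightarrow> card F < 2 * card E"
  shows "optimal (Suc (Suc q)) (times_cube (Suc q) E 1)"
proof (rule optimalI)
  have "E \<subseteq> Pow {1..Suc q}" using optimalD(1)[OF E(1)] by (simp add: admissible_def)
  then have card: "card (times_cube (Suc q) E 1) = 2 * card E" by (rule card_times_cube_1)
  show "admissible (Suc (Suc q)) (times_cube (Suc q) E 1)"
    using admissible_times_cube[OF optimalD(1)[OF E(1)], of 1] by simp
  show "left_compressed (Suc (Suc q)) (times_cube (Suc q) E 1)"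
    using left_compressed_times_cube[OF optimalD(2,5)[OF E(1)], of 1] by simp
  fix F assume F: "admissible (Suc (Suc q)) F" "left_compressed (Suc (Suc q)) F"
  have red: "2 \<le> card (A \<inter> B \<inter> {1..q})" if "A \<in> F" "B \<in> F" "2 * card E \<le> card F" for A B
  proof (rule ccontr)
    assume "\<not> 2 \<le> card (A \<inter> B \<inter> {1..q})"
    then have "card (A \<inter> B \<inter> {1..q}) < 2" by simp
    then have "card F < 2 * card E"
      by (intro irr F irreducible_large[OF F that(1,2)])
    then show False using that(3) by simp
  qed
  show "card F \<le> card (times_cube (Suc q) E 1)"
  proof (cases "2 * card E \<le> card F")
    case True
    show ?thesis unfolding card
      by (rule card_reducible_le(1)[OF E(1) F(1)]) (rule red[OF _ _ True])
  qed (use card in linarith)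
  assume cardF: "card F = card (times_cube (Suc q) E 1)"
    and max: "\<And>G. admissible (Suc (Suc q)) G \<Longrightarrow> card G \<le> card F"
  have eq: "card F = 2 * card E" using cardF card by simp
  then have red': "2 \<le> card (A \<inter> B \<inter> {1..q})" if "A \<in> F" "B \<in> F" for A B
    using red that by simp
  have up: "up_closed (Suc (Suc q)) F" by (rule up_closed_if_maximum[OF F(1) max])
  have folds: "card (fold_family q F 4 1) = card E" "card (fold_family q F 3 2) = card E"
    using card_reducible_le(2)[OF E(1) F(1) red' eq] by simp_all
  have "admissible (Suc q) (fold_family q F 3 2)"
    by (rule admissible_fold_family[OF F(1) red']) simp_all
  then have "fold_family q F 3 2 = E"
    by (rule optimalD(4)[OF E(1) _ left_compressed_fold_family[OF F(2) up] folds(2)])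
  then show "F = times_cube (Suc q) E 1"
    by (rule family_eq_times_cube[OF F up _ E(2) folds(1)])
qed

text \<open>The step in which the maximum weight increases. A family larger than
  \<open>2 * card E\<close> cannot be reducible, so the bound for the irreducible case and its
  equality case apply.\<close>

lemma optimal_extremal_family:
  assumes E: "optimal (2 * k) E" and k: "3 \<le> k"
    and less: "2 * card E < card (extremal_family (2 * k + 1))"
  shows "optimal (2 * k + 1) (extremal_family (2 * k + 1))"
proof (rule optimalI)
  define q where "q = 2 * k - 1"
  have q: "Suc q = 2 * k" "Suc (Suc q) = 2 * k + 1" using k by (simp_all add: q_def)
  show "admissible (2 * k + 1) (extremal_family (2 * k + 1))"
    "left_compressed (2 * k + 1) (extremal_family (2 * k + 1))"
    using k by (rule admissible_extremal_family, rule left_compressed_extremal_family)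
  fix F assume F: "admissible (2 * k + 1) F" "left_compressed (2 * k + 1) F"
  have large: "2 * k - 1 \<le> card Z" if big: "2 * card E < card F" and Z: "Z \<in> F" "1 \<notin> Z" for Z
  proof (cases "\<exists>A\<in>F. \<exists>B\<in>F. card (A \<inter> B \<inter> {1..q}) < 2")
    case True
    then obtain A B where "A \<in> F" "B \<in> F" "card (A \<inter> B \<inter> {1..q}) < 2" by (elim bexE)
    then show ?thesis
      using irreducible_large[of q F A B Z] F q Z by (simp add: q_def)
  next
    case False
    then have "2 \<le> card (A \<inter> B \<inter> {1..q})" if "A \<in> F" "B \<in> F" for A B
      using that by (meson not_less)
    then show ?thesis using card_reducible_le(1)[of q E F] E F q big by simp
  qed
  have k1: "1 \<le> k" using k by simp
  show "card F \<le> card (extremal_family (2 * k + 1))"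
  proof (cases "2 * card E < card F")
    case True
    show ?thesis by (rule irreducible_bound_odd(1)[OF F k1 large[OF True]])
  qed (use less in linarith)
  assume eq: "card F = card (extremal_family (2 * k + 1))"
  then have "2 * card E < card F" using less by simp
  then show "F = extremal_family (2 * k + 1)"
    by (intro irreducible_bound_odd(2)[OF F k1 large eq])
qed

section \<open>The family on seven points and its products\<close>

lemma extremal_family_ground: "extremal_family n \<subseteq> Pow {1..n}"
  by (auto simp: extremal_family_def)

lemma extremal_family_7: "extremal_family 7 = {A. A \<subseteq> {1..7} \<and> 5 \<le> card A}"
  by (auto simp: extremal_family_def)

text \<open>At \<open>n = 7\<close> both thresholds are 5, which makes this Katona's extremal family
  for \<open>t = 3\<close> on seven points, as \<open>3 + 7 = 2 * 5\<close>.\<close>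

lemma optimal_7: "optimal 7 (extremal_family 7)"
proof (rule optimalI)
  show "admissible 7 (extremal_family 7)" "left_compressed 7 (extremal_family 7)"
    using admissible_extremal_family[of 3] left_compressed_extremal_family[of 3] by simp_all
  have card: "card (extremal_family 7) = binomial_tail 7 5"
    unfolding extremal_family_7 by (rule card_large_subsets) auto
  fix F assume F: "admissible 7 F" "left_compressed 7 F"
  have F': "F \<subseteq> Pow {Suc 0..0 + 7}" "compressed_above 0 (0 + 7) F" "t_intersecting 3 F"
    using F by (simp_all add: admissible_def left_compressed_iff)
  show "card F \<le> card (extremal_family 7)"
    using katona_bound[of F 0 7 0 3 5] F' card by simp
  show "F = extremal_family 7" if "card F = card (extremal_family 7)"
    unfolding extremal_family_7 using katona_unique[of F 0 7 3 5] F' that card by simp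
qed

text \<open>A trace outside the family has at most four points in \<open>[7]\<close>. Split these
  into two parts of at most two points; the complements of the parts in \<open>[7]\<close> are the
  blocking sets. The point \<open>q + 1\<close> lies beyond \<open>[7]\<close>.\<close>

lemma blocking_times_cube_7:
  assumes "7 \<le> q"
  shows "blocking q (times_cube 7 (extremal_family 7) (Suc q - 7))"
  unfolding blocking_def
proof (intro allI impI)
  let ?E = "times_cube 7 (extremal_family 7) (Suc q - 7)"
  have E: "A \<in> ?E \<longleftrightarrow> A \<subseteq> {1..Suc q} \<and> 5 \<le> card (A \<inter> {1..7})" for A
    using assms by (auto simp: times_cube_def extremal_family_7)
  have strip: "insert (Suc q) A \<inter> {1..7} = A \<inter> {1..7}" for A using assms by auto
  fix X assume X: "X \<subseteq> {1..q}" "insert (Suc q) X \<notin> ?E"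
  have "insert (Suc q) X \<subseteq> {1..Suc q}" using X(1) by auto
  then have small: "card (X \<inter> {1..7}) \<le> 4" using X(2) unfolding E strip by simp
  have "min 2 (card (X \<inter> {1..7})) \<le> card (X \<inter> {1..7})" by simp
  then obtain C where C: "C \<subseteq> X \<inter> {1..7}" "card C = min 2 (card (X \<inter> {1..7}))"
    by (rule obtain_subset_with_card_n)
  define Y Z where "Y = {1..7} - C" and "Z = {1..7} - (X \<inter> {1..7} - C)"
  have finC: "finite C" using C(1) finite_subset by blast
  have "card Y = 7 - card C" using C(1) finC by (simp add: Y_def card_Diff_subset)
  then have Y5: "5 \<le> card Y" using C(2) by simp
  have "card (X \<inter> {1..7} - C) = card (X \<inter> {1..7}) - card C" using C(1) finC by (simp add: card_Diff_subset)
  then have "card (X \<inter> {1..7} - C) \<le> 2" using C(2) small by simp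
  moreover have "card Z = 7 - card (X \<inter> {1..7} - C)"
    unfolding Z_def by (subst card_Diff_subset) auto
  ultimately have Z5: "5 \<le> card Z" by simp
  have sub: "Y \<subseteq> {1..7}" "Z \<subseteq> {1..7}" by (auto simp: Y_def Z_def)
  then have sub': "Y \<subseteq> {1..q}" "Z \<subseteq> {1..q}" using assms by auto
  then have "Y \<in> ?E" "insert (Suc q) Z \<in> ?E"
    unfolding E strip using sub Y5 Z5 by (auto simp: Int_absorb2)
  moreover have "Y \<inter> Z \<inter> X = {}" by (auto simp: Y_def Z_def)
  ultimately show "\<exists>Y Z. Y \<subseteq> {1..q} \<and> Z \<subseteq> {1..q} \<and> Y \<in> ?E \<and> insert (Suc q) Z \<in> ?E \<and> Y \<inter> Z \<inter> X = {}"
    using sub' by - (rule exI[of _ Y], rule exI[of _ Z], intro conjI)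
qed

section \<open>Central binomial coefficients and the change at \<open>n = 73\<close>\<close>

lemma central_binomial_Suc: "Suc k * (2 * Suc k choose Suc k) = 2 * (2 * k + 1) * (2 * k choose k)"
proof -
  \<comment> \<open>A further factor \<open>Suc k\<close> lets the absorption identity be applied
    twice without division; it is cancelled at the end.\<close>
  have "Suc k * (Suc k * (2 * Suc k choose Suc k)) = Suc k * (Suc (2 * k + 1) * (2 * k + 1 choose k))"
    using Suc_times_binomial_eq[of "2 * k + 1" k] by (simp add: mult.commute)
  also have "(2 * k + 1 choose k) = (2 * k + 1 choose Suc k)"
    using binomial_symmetric[of k "2 * k + 1"] by simp
  also have "Suc k * (Suc (2 * k + 1) * (2 * k + 1 choose Suc k)) = Suc (2 * k + 1) * (Suc (2 * k) * (2 * k choose k))"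
    using Suc_times_binomial_eq[of "2 * k" k] by (simp add: algebra_simps)
  also have "\<dots> = Suc k * (2 * (2 * k + 1) * (2 * k choose k))" by simp
  finally show ?thesis by (simp only: mult_cancel1) simp
qed

text \<open>The central coefficient grows by a factor of at least 3 in each step and the quadratic
  by at most 3. The start is \<open>186 < 252\<close> at \<open>k = 5\<close>.\<close>

lemma central_binomial_gt:
  assumes "5 \<le> k"
  shows "Suc k * (6 * k + 1) < (2 * k choose k)"
  using assms
proof (induction k rule: dec_induct)
  case base
  show ?case by (simp add: binomial_fact' fact_numeral)
next
  case (step m)
  have "Suc m * (3 * (2 * m choose m)) \<le> Suc m * (2 * Suc m choose Suc m)"
  proof -
    have "3 * Suc m * (2 * m choose m) \<le> 2 * (2 * m + 1) * (2 * m choose m)"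
      using step.hyps by (intro mult_le_mono1) simp
    then show ?thesis unfolding central_binomial_Suc by (simp only: ac_simps)
  qed
  then have "3 * (2 * m choose m) \<le> (2 * Suc m choose Suc m)" by (simp only: Suc_mult_le_cancel1)
  moreover have "Suc (Suc m) * (6 * Suc m + 1) \<le> 3 * (Suc m * (6 * m + 1))"
  proof -
    have "m * 1 \<le> m * (m * 12)" using step.hyps by (intro mult_le_mono2) linarith
    then have "11 \<le> m * 2 + m * (m * 12)" using step.hyps by linarith
    then show ?thesis by (simp add: algebra_simps)
  qed
  ultimately show ?case using step.IH by linarith
qed

abbreviation extremal_size :: "nat \<Rightarrow> nat" where
  "extremal_size k \<equiv> binomial_tail (2 * k) (k + 1) + 2 * k + 1"

lemma extremal_size_eq: "2 * extremal_size k + (2 * k choose k) = 4 ^ k + 4 * k + 2"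
  using binomial_tail_central[of k] by simp

text \<open>The weight of the extremal family increases from \<open>n = 2 * k + 1\<close> to
  \<open>n + 2\<close>. By \<open>extremal_size_eq\<close> the claim says that four times the
  central coefficient exceeds the next one by more than \<open>12 * k + 2\<close>; multiplied by
  \<open>Suc k\<close>, this difference is twice the central coefficient.\<close>

lemma extremal_size_growth:
  assumes "5 \<le> k"
  shows "4 * extremal_size k < extremal_size (Suc k)"
proof -
  have "Suc k * (4 * (2 * k choose k)) = Suc k * (2 * Suc k choose Suc k) + 2 * (2 * k choose k)"
    unfolding central_binomial_Suc by (simp add: algebra_simps)
  also have "\<dots> > Suc k * (2 * Suc k choose Suc k) + 2 * (Suc k * (6 * k + 1))"
    using central_binomial_gt[OF assms] by simp
  finally have "Suc k * ((2 * Suc k choose Suc k) + 2 * (6 * k + 1)) < Suc k * (4 * (2 * k choose k))"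
    by (simp add: algebra_simps)
  then have "(2 * Suc k choose Suc k) + 2 * (6 * k + 1) < 4 * (2 * k choose k)"
    by (simp only: Suc_mult_less_cancel1)
  then show ?thesis
    using extremal_size_eq[of k] extremal_size_eq[of "Suc k"] by simp
qed

text \<open>The right side is the size of the product of the family on \<open>[7]\<close> with a
  cube, on \<open>[2 * k + 1]\<close>. By the growth lemma the quotient of the two sides increases
  from \<open>k = 5\<close> on, so \<open>k = 35\<close> is the decisive comparison;
  \<open>k = 4\<close> is computed separately.\<close>

lemma extremal_size_less:
  assumes "4 \<le> k" "k \<le> 35"
  shows "extremal_size k < 29 * 4 ^ (k - 3)"
proof (cases "k = 4")
  case True
  have "(2 * 4 choose 4 :: nat) = 70" by (simp add: binomial_fact' fact_numeral)
  then show ?thesis using extremal_size_eq[of 4] True by simp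
next
  case False
  have "4 ^ (35 - k) * extremal_size k \<le> extremal_size 35"
    using assms(2)
  proof (induction k rule: inc_induct)
    case base
    show ?case by simp
  next
    case (step m)
    have growth: "4 * extremal_size m \<le> extremal_size (Suc m)"
      using step.hyps assms(1) False extremal_size_growth[of m] by simp
    have "35 - m = Suc (35 - Suc m)" using step.hyps by simp
    then have "4 ^ (35 - m) * extremal_size m = 4 ^ (35 - Suc m) * (4 * extremal_size m)"
      by (simp only: power_Suc2 mult.assoc)
    also have "\<dots> \<le> 4 ^ (35 - Suc m) * extremal_size (Suc m)"
      using growth by (rule mult_le_mono2)
    also note step.IH
    finally show ?case .
  qed
  also have "extremal_size 35 < 29 * 4 ^ 32"
  proof -
    have "(2 * 35 choose 35 :: nat) = 112186277816662845432" by (simp add: binomial_fact' fact_numeral)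
    then show ?thesis using extremal_size_eq[of 35] by simp
  qed
  also have "(29 :: nat) * 4 ^ 32 = 4 ^ (35 - k) * (29 * 4 ^ (k - 3))"
    using assms by (simp flip: power_add)
  finally show ?thesis by (simp only: mult_less_cancel1)
qed

text \<open>At \<open>n = 73\<close> the comparison with the product of the family on
  \<open>[7]\<close> is reversed.\<close>

lemma extremal_size_36: "29 * 4 ^ 33 < extremal_size 36"
proof -
  have "(2 * 36 choose 36 :: nat) = 442512540276836779204" by (simp add: binomial_fact' fact_numeral)
  then show ?thesis using extremal_size_eq[of 36] by simp
qed
text \<open>The members avoiding 1 number at most \<open>2 * k + 2\<close>, against
  \<open>4 * k + 2\<close> in two copies of the extremal family, while the bounds for the members
  through 1 agree.\<close>

lemma irreducible_even_less:
  assumes "admissible (Suc (2 * k + 1)) F" "left_compressed (Suc (2 * k + 1)) F"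
    "\<And>Z. Z \<in> F \<Longrightarrow> 1 \<notin> Z \<Longrightarrow> 2 * k \<le> card Z" "1 \<le> k"
  shows "card F < 2 * extremal_size k"
  using irreducible_bound_even[of k F] assms by simp

lemma optimal_extremal_family_step:
  assumes "optimal (2 * k + 1) (extremal_family (2 * k + 1))" "3 \<le> k"
  shows "optimal (2 * k + 2) (times_cube (2 * k + 1) (extremal_family (2 * k + 1)) 1)"
proof -
  have "optimal (Suc (Suc (2 * k))) (times_cube (Suc (2 * k)) (extremal_family (Suc (2 * k))) 1)"
  proof (rule optimal_times_cube)
    show "optimal (Suc (2 * k)) (extremal_family (Suc (2 * k)))" using assms(1) by simp
    show "blocking (2 * k) (extremal_family (Suc (2 * k)))"
      by (rule blocking_extremal_family[OF assms(2)])
    fix F assume "admissible (Suc (Suc (2 * k))) F" "left_compressed (Suc (Suc (2 * k))) F"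
      "\<And>Z. Z \<in> F \<Longrightarrow> 1 \<notin> Z \<Longrightarrow> 2 * k \<le> card Z"
    then show "card F < 2 * card (extremal_family (Suc (2 * k)))"
      using irreducible_even_less[of k F] card_extremal_family[of k] assms(2) by simp
  qed
  then show ?thesis by simp
qed

section \<open>Induction on the size of the ground set\<close>

lemma card_extremal_family_7: "card (extremal_family 7) = 29"
proof -
  have "(2 * 3 choose 3 :: nat) = 20" by (simp add: binomial_fact' fact_numeral)
  then show ?thesis using card_extremal_family[of 3] extremal_size_eq[of 3] by simp
qed

lemma card_times_cube_7: "card (times_cube 7 (extremal_family 7) k) = 29 * 2 ^ k"
  by (simp add: card_times_cube[OF extremal_family_ground] card_extremal_family_7)

text \<open>Up to \<open>n = 72\<close> every step is a product step. The irreducible families are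
  too small: for even \<open>n\<close> they stay below twice the extremal family on
  \<open>[n - 1]\<close>, for odd \<open>n\<close> below \<open>extremal_size_less\<close>.\<close>

lemma optimal_small:
  assumes "7 \<le> n" "n \<le> 72"
  shows "optimal n (times_cube 7 (extremal_family 7) (n - 7))"
  using assms
proof (induction n rule: dec_induct)
  case base
  have "times_cube 7 (extremal_family 7) (7 - 7) = extremal_family 7"
    using times_cube_0[OF extremal_family_ground] by simp
  then show ?case using optimal_7 by (simp only:)
next
  case (step m)
  define q where "q = m - 1"
  have m: "m = Suc q" using step.hyps by (simp add: q_def)
  let ?E = "times_cube 7 (extremal_family 7) (Suc q - 7)"
  have cardE: "card ?E = 29 * 2 ^ (Suc q - 7)" by (rule card_times_cube_7)
  have "optimal (Suc (Suc q)) (times_cube (Suc q) ?E 1)"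
  proof (rule optimal_times_cube)
    show "optimal (Suc q) ?E" using step m by simp
    \<comment> \<open>In the first step \<open>q + 1 = 7\<close> still belongs to
      \<open>[7]\<close>, so blocking comes from the extremal family with
      \<open>k = 3\<close>.\<close>
    show "blocking q ?E"
    proof (cases "q = 6")
      case True
      then have "?E = extremal_family 7"
        using times_cube_0[OF extremal_family_ground] by simp
      then show ?thesis using True blocking_extremal_family[of 3] by simp
    next
      case False
      then show ?thesis using step.hyps m by (intro blocking_times_cube_7) simp
    qed
    fix F assume F: "admissible (Suc (Suc q)) F" "left_compressed (Suc (Suc q)) F"
      "\<And>Z. Z \<in> F \<Longrightarrow> 1 \<notin> Z \<Longrightarrow> q \<le> card Z"
    show "card F < 2 * card ?E"
    proof (cases "even q")
      case True
      then obtain k where k: "q = 2 * k" by (elim evenE)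
      have k': "3 \<le> k" "k \<le> 35" using k m step by simp_all
      have "card F < 2 * extremal_size k"
        using irreducible_even_less[of k F] F k k' by simp
      also have "extremal_size k \<le> 29 * 4 ^ (k - 3)"
      proof (cases "k = 3")
        case True
        then show ?thesis using card_extremal_family[of 3] card_extremal_family_7 by simp
      next
        case False
        then show ?thesis using extremal_size_less[of k] k' by simp
      qed
      also have "(4::nat) ^ (k - 3) = 2 ^ (Suc q - 7)"
      proof -
        have "2 * (k - 3) = Suc q - 7" using k k' by simp
        then have "(2::nat) ^ (2 * (k - 3)) = 2 ^ (Suc q - 7)" by (simp only:)
        then show ?thesis by (simp add: power_mult)
      qed
      finally show ?thesis using cardE by simp
    next
      case False
      then obtain j where j: "q = 2 * j + 1" by (elim oddE)
      define k where "k = Suc j"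
      have k: "Suc (Suc q) = 2 * k + 1" "q = 2 * k - 1" using j by (simp_all add: k_def)
      have k': "4 \<le> k" "k \<le> 35" using k m step by simp_all
      have "card F \<le> extremal_size k"
        using irreducible_bound_odd(1)[of k F] F k k' card_extremal_family[of k] by simp
      also have "\<dots> < 29 * 4 ^ (k - 3)" by (rule extremal_size_less[OF k'])
      also have "(4::nat) ^ (k - 3) = 2 * 2 ^ (Suc q - 7)"
      proof -
        have "2 * (k - 3) = Suc (Suc q - 7)" using k k' by simp
        then have "(2::nat) ^ (2 * (k - 3)) = 2 * 2 ^ (Suc q - 7)" by (simp only: power_Suc)
        then show ?thesis by (simp add: power_mult)
      qed
      finally show ?thesis using cardE by simp
    qed
  qed
  moreover have "times_cube (Suc q) ?E 1 = times_cube 7 (extremal_family 7) (Suc m - 7)"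
  proof -
    have "7 + (Suc q - 7) = Suc q" "Suc (Suc q - 7) = Suc m - 7" using step.hyps m by simp_all
    then show ?thesis using times_cube_Suc[of 7 "Suc q - 7" "extremal_family 7"] by (simp only:)
  qed
  ultimately show ?case using m by simp
qed

text \<open>From \<open>2 * m + 1\<close> a product step leads to \<open>2 * m + 2\<close>, and
  since the size more than quadruples over two steps, the extremal family wins again at
  \<open>2 * m + 3\<close>. The start rests on the product family at \<open>n = 72\<close>.\<close>

lemma optimal_large:
  assumes "36 \<le> k"
  shows "optimal (2 * k + 1) (extremal_family (2 * k + 1))"
  using assms
proof (induction k rule: dec_induct)
  case base
  show ?case
  proof (rule optimal_extremal_family)
    show "optimal (2 * 36) (times_cube 7 (extremal_family 7) (72 - 7))"
      using optimal_small[of 72] by simp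
    show "2 * card (times_cube 7 (extremal_family 7) (72 - 7)) < card (extremal_family (2 * 36 + 1))"
      using extremal_size_36 card_extremal_family[of 36] unfolding card_times_cube_7 by simp
  qed simp
next
  case (step m)
  let ?E = "times_cube (2 * m + 1) (extremal_family (2 * m + 1)) 1"
  show ?case
  proof (rule optimal_extremal_family)
    show "optimal (2 * Suc m) ?E"
      using optimal_extremal_family_step[OF step.IH] step.hyps by simp
    have "card ?E = 2 * extremal_size m"
      using card_times_cube_1[OF extremal_family_ground, of "2 * m + 1"] card_extremal_family[of m] step.hyps
      by simp
    then show "2 * card ?E < card (extremal_family (2 * Suc m + 1))"
      using extremal_size_growth[of m] card_extremal_family[of "Suc m"] step.hyps by simp
  qed (use step.hyps in simp)
qed

section \<open>From sizes to weights\<close>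

lemma max_weight_optimal:
  assumes "optimal n E"
  shows "max_weight n = weight n E"
    and "admissible n F \<and> left_compressed n F \<and> weight n F = max_weight n \<longleftrightarrow> F = E"
proof -
  have "{weight n F | F. admissible n F} \<subseteq> weight n ` Pow (Pow {1..n})"
    by (auto simp: admissible_def)
  then have "finite {weight n F | F. admissible n F}"
    by (rule finite_subset) simp
  then show eq: "max_weight n = weight n E"
    unfolding max_weight_def
  proof (rule Max_eqI)
    fix y assume "y \<in> {weight n F | F. admissible n F}"
    then obtain F where "admissible n F" "y = weight n F" by blast
    then show "y \<le> weight n E"
      using optimalD(3)[OF assms, of F] by (simp add: weight_def divide_right_mono)
  next
    show "weight n E \<in> {weight n F | F. admissible n F}"
      using optimalD(1)[OF assms] by blast
  qed
  have "weight n F = weight n E \<longleftrightarrow> card F = card E"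
    by (simp add: weight_def)
  then show "admissible n F \<and> left_compressed n F \<and> weight n F = max_weight n \<longleftrightarrow> F = E"
    using optimalD(1,2,4)[OF assms] eq by metis
qed

lemma weight_times_cube:
  assumes "F \<subseteq> Pow {1..m}"
  shows "weight (m + k) (times_cube m F k) = weight m F"
  by (simp add: weight_def card_times_cube[OF assms] power_add)

theorem theorem1:
  fixes n :: nat
  assumes "7 \<le> n"
  shows
    "(n \<le> 72 \<longrightarrow>
        max_weight n = weight 7 (extremal_family 7) \<and>
        (\<forall>F. (admissible n F \<and> left_compressed n F \<and> weight n F = max_weight n) \<longleftrightarrow>
             F = times_cube 7 (extremal_family 7) (n - 7))) \<and>
     (73 \<le> n \<and> odd n \<longrightarrow>
        max_weight n = weight n (extremal_family n) \<and>
        (\<forall>F. (admissible n F \<and> left_compressed n F \<and> weight n F = max_weight n) \<longleftrightarrow>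
             F = extremal_family n)) \<and>
     (74 \<le> n \<and> even n \<longrightarrow>
        max_weight n = weight (n - 1) (extremal_family (n - 1)) \<and>
        (\<forall>F. (admissible n F \<and> left_compressed n F \<and> weight n F = max_weight n) \<longleftrightarrow>
             F = times_cube (n - 1) (extremal_family (n - 1)) 1))"
proof (intro conjI impI allI)
  {
    assume "n \<le> 72"
    then have opt: "optimal n (times_cube 7 (extremal_family 7) (n - 7))"
      using assms by (intro optimal_small)
    show "max_weight n = weight 7 (extremal_family 7)"
      using max_weight_optimal(1)[OF opt] weight_times_cube[OF extremal_family_ground[of 7], of "n - 7"] assms by simp
    show "admissible n F \<and> left_compressed n F \<and> weight n F = max_weight n \<longleftrightarrow>
        F = times_cube 7 (extremal_family 7) (n - 7)" for F
      by (rule max_weight_optimal(2)[OF opt])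
  }
  {
    assume n: "73 \<le> n \<and> odd n"
    then obtain k where "n = 2 * k + 1" by (elim conjE oddE)
    then have opt: "optimal n (extremal_family n)"
      using n optimal_large[of k] by simp
    show "max_weight n = weight n (extremal_family n)"
      by (rule max_weight_optimal(1)[OF opt])
    show "admissible n F \<and> left_compressed n F \<and> weight n F = max_weight n \<longleftrightarrow> F = extremal_family n" for F
      by (rule max_weight_optimal(2)[OF opt])
  }
  {
    assume n: "74 \<le> n \<and> even n"
    then obtain j where j: "n = 2 * j" by (elim conjE evenE)
    define k where "k = j - 1"
    have k: "n = 2 * k + 2" "n - 1 = 2 * k + 1" "36 \<le> k" using n j by (simp_all add: k_def)
    then have opt: "optimal n (times_cube (n - 1) (extremal_family (n - 1)) 1)"
      using optimal_extremal_family_step[OF optimal_large[OF k(3)]] by simp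
    show "max_weight n = weight (n - 1) (extremal_family (n - 1))"
      using max_weight_optimal(1)[OF opt] weight_times_cube[OF extremal_family_ground[of "n - 1"], of 1] n by simp
    show "admissible n F \<and> left_compressed n F \<and> weight n F = max_weight n \<longleftrightarrow>
        F = times_cube (n - 1) (extremal_family (n - 1)) 1" for F
      by (rule max_weight_optimal(2)[OF opt])
  }
qed

end
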